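(* Let $G$ be a topological group. Suppose that $G$ admits a bounded right-invariant metric $d$ generating the topology of $G$, as well as a set $\mathscr{H}$ of amenable topological subgroups of $G$ such that (1) $(\mathscr{H},\subseteq)$ is directed, (2) $G=\overline{\bigcup\mathscr{H}}$, (3) $\liminf_{H\in\mathscr{H}}\ell(H,d|_{H\times H})=0$. Then $\ell(G)=0$. In particular, $G$ is extremely amenable.
   Context: For a topological group $G$, $\mathrm{RUCB}(G)$ is the algebra of all bounded functions $f\colon G\to\mathbb{R}$ such that for every $\epsilon>0$ there is a neighborhood $U$ of $e$ with $\sup_{x\in G}|f(x)-f(gx)|\le\epsilon$ for all $g\in U$. $G$ is amenable if there is a positive unital linear functional $\mu$ on $\mathrm{RUCB}(G)$ with $\mu(f\circ\lambda_g)=\mu(f)$ for all $f\in\mathrm{RUCB}(G)$, $g\in G$, where $\lambda_g(x)=gx$. $G$ is extremely amenable if every (jointly) continuous action of $G$ on a non-empty compact Hausdorff space has a fixed point. Subgroups carry the relative topology. The limit inferior is along the directed set $(\mathscr{H},\subseteq)$, i.e., $\sup_{H_0\in\mathscr{H}}\inf_{H\in\mathscr{H},\,H\supseteq H_0}\ell(H,d|_{H\times H})$. Amenable length. $\Delta(G)$ is the set of all bounded, continuous, right-invariant pseudo-metrics on $G$ (continuous: the generated topology is contained in that of $G$; right-invariant: $d(xg,yg)=d(x,y)$). $\mathscr{A}(G)$ is the set of all amenable topological subgroups of $G$, and $\mathscr{A}^*(G)$ is the set of all finite tuples $(G_0,\dots,G_n)$, $n\in\mathbb{N}$, of members of $\mathscr{A}(G)$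 with $\{e\}=G_0\le\dots\le G_n=G$. For $d\in\Delta(G)$ and $(G_0,\dots,G_n)\in\mathscr{A}^*(G)$ let $$\ell(G_0,\dots,G_n;d):=\Bigl(\sum_{i=0}^{n-1}\bigl(\sup_{g\in G}\operatorname{diam}(G_{i+1}/G_i,d_i^g)\bigr)^2\Bigr)^{1/2},\qquad d_i^g(xG_i,yG_i):=\inf_{h\in G_i}d(gx,gyh),$$ and let $\ell(G,d):=\inf\{\ell(G_0,\dots,G_n;d)\mid(G_0,\dots,G_n)\in\mathscr{A}^*(G)\}\in[0,\infty]$ (with $\inf\emptyset=\infty$). For a neighborhood $U$ of $e$ in $G$ and a finite subset $F\subseteq G$, let $\mathrm{T}_G(U,F)$ be the set of all pairs $(H,d)$ with $H\in\mathscr{A}(G)$, $d\in\Delta(H)$, $F\subseteq UH$ and $\{x\in H\mid d(e,x)<1\}\subseteq U$. Then $$\ell(G):=\sup\Bigl\{\inf_{(H,d)\in\mathrm{T}_G(U,F)}\ell(H,d)\ \Big|\ U\text{ neighborhood of }e,\ F\subseteq G\text{ finite}\Bigr\}\in[0,\infty].$$ *)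

theory Defs
  imports
    "HOL-Analysis.Analysis"
    "HOL-Algebra.Left_Coset"
    "HOL-Algebra.Group_Action"
begin

text \<open>
  Functions on a group (real-valued functions, pseudo-metrics) are total HOL functions of which
  only the values on the carrier matter. Hence a pseudo-metric on a group is restricted to a
  subgroup simply by replacing the carrier. A subgroup \<open>H\<close> of \<open>(G, T)\<close> is viewed as the
  topological group \<open>(G\<lparr>carrier := H\<rparr>, subtopology T H)\<close>.
\<close>

locale topological_group = group G for G (structure) +
  fixes T :: "'a topology"
  assumes topspace_eq: "topspace T = carrier G"
    and continuous_mult: "continuous_map (prod_topology T T) T (\<lambda>(x, y). x \<otimes> y)"
    and continuous_inv: "continuous_map T T (\<lambda>x. inv x)"

definition neighbourhood_in :: "'a topology \<Rightarrow> 'a \<Rightarrow> 'a set \<Rightarrow> bool" where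
  "neighbourhood_in T x U \<longleftrightarrow> U \<subseteq> topspace T \<and> (\<exists>V. openin T V \<and> x \<in> V \<and> V \<subseteq> U)"


section \<open>Amenability and extreme amenability\<close>

definition RUCB :: "('a, 'm) monoid_scheme \<Rightarrow> 'a topology \<Rightarrow> ('a \<Rightarrow> real) set" where
  "RUCB G T = {f. bounded (f ` carrier G) \<and>
     (\<forall>\<epsilon>>0. \<exists>U. neighbourhood_in T \<one>\<^bsub>G\<^esub> U \<and>
        (\<forall>g\<in>U. \<forall>x\<in>carrier G. \<bar>f x - f (g \<otimes>\<^bsub>G\<^esub> x)\<bar> \<le> \<epsilon>))}"

text \<open>
  Positivity only looks at values on the carrier; together with linearity it therefore forces
  \<open>\<mu> f = \<mu> f'\<close> whenever \<open>f\<close> and \<open>f'\<close> agree on the carrier, so that \<open>\<mu>\<close> is indeed a functional on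
  the algebra of functions \<open>carrier G \<rightarrow> \<real>\<close>.
\<close>
definition amenable :: "('a, 'm) monoid_scheme \<Rightarrow> 'a topology \<Rightarrow> bool" where
  "amenable G T \<longleftrightarrow> (\<exists>\<mu> :: ('a \<Rightarrow> real) \<Rightarrow> real.
     (\<forall>f\<in>RUCB G T. \<forall>f'\<in>RUCB G T. \<mu> (\<lambda>x. f x + f' x) = \<mu> f + \<mu> f') \<and>
     (\<forall>c. \<forall>f\<in>RUCB G T. \<mu> (\<lambda>x. c * f x) = c * \<mu> f) \<and>
     (\<forall>f\<in>RUCB G T. (\<forall>x\<in>carrier G. 0 \<le> f x) \<longrightarrow> 0 \<le> \<mu> f) \<and>
     \<mu> (\<lambda>_. 1) = 1 \<and>
     (\<forall>f\<in>RUCB G T. \<forall>g\<in>carrier G. \<mu> (\<lambda>x. f (g \<otimes>\<^bsub>G\<^esub> x)) = \<mu> f))"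

text \<open>
  HOL cannot quantify over types inside a definition. The type argument is the type of the points of
  the compact spaces; a statement with a schematic \<open>'x\<close> covers all compact Hausdorff spaces.
\<close>
definition extremely_amenable ::
    "'x itself \<Rightarrow> ('a, 'm) monoid_scheme \<Rightarrow> 'a topology \<Rightarrow> bool" where
  "extremely_amenable _ G T \<longleftrightarrow>
     (\<forall>(X :: 'x topology) \<phi>.
        compact_space X \<and> Hausdorff_space X \<and> topspace X \<noteq> {} \<and>
        group_action G (topspace X) \<phi> \<and>
        continuous_map (prod_topology T X) X (\<lambda>(g, x). \<phi> g x) \<longrightarrow>
        (\<exists>x\<in>topspace X. \<forall>g\<in>carrier G. \<phi> g x = x))"


section \<open>Pseudo-metrics\<close>

definition pseudo_metric_on :: "'a set \<Rightarrow> ('a \<Rightarrow> 'a \<Rightarrow> real) \<Rightarrow> bool" where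
  "pseudo_metric_on M d \<longleftrightarrow>
     (\<forall>x\<in>M. \<forall>y\<in>M. 0 \<le> d x y) \<and>
     (\<forall>x\<in>M. d x x = 0) \<and>
     (\<forall>x\<in>M. \<forall>y\<in>M. d x y = d y x) \<and>
     (\<forall>x\<in>M. \<forall>y\<in>M. \<forall>z\<in>M. d x z \<le> d x y + d y z)"

definition pseudo_metric_open :: "'a set \<Rightarrow> ('a \<Rightarrow> 'a \<Rightarrow> real) \<Rightarrow> 'a set \<Rightarrow> bool" where
  "pseudo_metric_open M d U \<longleftrightarrow>
     U \<subseteq> M \<and> (\<forall>x\<in>U. \<exists>r>0. {y \<in> M. d x y < r} \<subseteq> U)"

definition bounded_dist_on :: "'a set \<Rightarrow> ('a \<Rightarrow> 'a \<Rightarrow> real) \<Rightarrow> bool" where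
  "bounded_dist_on M d \<longleftrightarrow> bounded ((\<lambda>(x, y). d x y) ` (M \<times> M))"

definition right_invariant :: "('a, 'm) monoid_scheme \<Rightarrow> ('a \<Rightarrow> 'a \<Rightarrow> real) \<Rightarrow> bool" where
  "right_invariant G d \<longleftrightarrow>
     (\<forall>x\<in>carrier G. \<forall>y\<in>carrier G. \<forall>g\<in>carrier G. d (x \<otimes>\<^bsub>G\<^esub> g) (y \<otimes>\<^bsub>G\<^esub> g) = d x y)"

definition Delta :: "('a, 'm) monoid_scheme \<Rightarrow> 'a topology \<Rightarrow> ('a \<Rightarrow> 'a \<Rightarrow> real) set" where
  "Delta G T = {d. pseudo_metric_on (carrier G) d \<and> bounded_dist_on (carrier G) d \<and>
     (\<forall>U. pseudo_metric_open (carrier G) d U \<longrightarrow> openin T U) \<and> right_invariant G d}"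


section \<open>Amenable length\<close>

definition amenable_subgroups :: "('a, 'm) monoid_scheme \<Rightarrow> 'a topology \<Rightarrow> 'a set set" where
  "amenable_subgroups G T =
     {H. subgroup H G \<and> amenable (G\<lparr>carrier := H\<rparr>) (subtopology T H)}"

definition amenable_chains :: "('a, 'm) monoid_scheme \<Rightarrow> 'a topology \<Rightarrow> 'a set list set" where
  "amenable_chains G T = {Hs. Hs \<noteq> [] \<and> set Hs \<subseteq> amenable_subgroups G T \<and>
     hd Hs = {\<one>\<^bsub>G\<^esub>} \<and> last Hs = carrier G \<and>
     (\<forall>i. Suc i < length Hs \<longrightarrow> Hs ! i \<subseteq> Hs ! Suc i)}"

text \<open>
  The function \<open>(xK, yK) \<mapsto> inf\<^sub>h\<^sub>\<in>\<^sub>K d (g x) (g y h)\<close> on left cosets, evaluated at chosen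
  representatives; by the lemma below the choice does not matter if \<open>d\<close> is right-invariant.
\<close>
definition coset_dist ::
    "('a, 'm) monoid_scheme \<Rightarrow> 'a set \<Rightarrow> ('a \<Rightarrow> 'a \<Rightarrow> real) \<Rightarrow> 'a \<Rightarrow> 'a set \<Rightarrow> 'a set \<Rightarrow> real" where
  "coset_dist G K d g A B =
     (INF h\<in>K. d (g \<otimes>\<^bsub>G\<^esub> (SOME x. x \<in> A)) (g \<otimes>\<^bsub>G\<^esub> (SOME y. y \<in> B) \<otimes>\<^bsub>G\<^esub> h))"

lemma coset_dist_l_coset:
  fixes G (structure)
  assumes "group G" and K: "subgroup K G" and d: "right_invariant G d"
    and g: "g \<in> carrier G" and x: "x \<in> carrier G" and y: "y \<in> carrier G"
  shows "coset_dist G K d g (x <# K) (y <# K) = (INF h\<in>K. d (g \<otimes> x) (g \<otimes> y \<otimes> h))"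
proof -
  interpret group G by fact
  interpret K: subgroup K G by fact
  have "(SOME z. z \<in> x <# K) \<in> x <# K"
    using lcos_self[OF x K] by (rule someI)
  then obtain k where k: "k \<in> K" and xk: "(SOME z. z \<in> x <# K) = x \<otimes> k"
    by (auto simp: l_coset_def)
  have "(SOME z. z \<in> y <# K) \<in> y <# K"
    using lcos_self[OF y K] by (rule someI)
  then obtain l where l: "l \<in> K" and yl: "(SOME z. z \<in> y <# K) = y \<otimes> l"
    by (auto simp: l_coset_def)
  note Kc = K.mem_carrier
  have eq: "d (g \<otimes> (x \<otimes> k)) (g \<otimes> (y \<otimes> l) \<otimes> h) = d (g \<otimes> x) (g \<otimes> y \<otimes> (l \<otimes> h \<otimes> inv k))"
    if h: "h \<in> K" for h
  proof -
    have "g \<otimes> (y \<otimes> l) \<otimes> h = g \<otimes> y \<otimes> (l \<otimes> h \<otimes> inv k) \<otimes> k"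
      using g y Kc[OF k] Kc[OF l] Kc[OF h] by (simp add: m_assoc)
    moreover have "g \<otimes> (x \<otimes> k) = (g \<otimes> x) \<otimes> k"
      using g x Kc[OF k] by (simp add: m_assoc)
    ultimately show ?thesis
      using d g x y Kc[OF k] Kc[OF l] Kc[OF h] by (simp add: right_invariant_def)
  qed
  have img: "(\<lambda>h. l \<otimes> h \<otimes> inv k) ` K = K"
  proof (intro equalityI subsetI)
    fix h assume h: "h \<in> K"
    have "h = l \<otimes> (inv l \<otimes> h \<otimes> k) \<otimes> inv k"
      using Kc[OF k] Kc[OF l] Kc[OF h] by (simp add: m_assoc) (simp flip: m_assoc)
    moreover have "inv l \<otimes> h \<otimes> k \<in> K"
      using h k l by simp
    ultimately show "h \<in> (\<lambda>h. l \<otimes> h \<otimes> inv k) ` K" by (rule image_eqI)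
  next
    fix h assume "h \<in> (\<lambda>h. l \<otimes> h \<otimes> inv k) ` K"
    then show "h \<in> K" using k l by auto
  qed
  have "(\<lambda>h. d (g \<otimes> (x \<otimes> k)) (g \<otimes> (y \<otimes> l) \<otimes> h)) ` K
      = (\<lambda>h. d (g \<otimes> x) (g \<otimes> y \<otimes> h)) ` ((\<lambda>h. l \<otimes> h \<otimes> inv k) ` K)"
    unfolding image_image by (intro image_cong refl eq)
  then show ?thesis
    unfolding coset_dist_def xk yl img by simp
qed

definition diam :: "'b set \<Rightarrow> ('b \<Rightarrow> 'b \<Rightarrow> real) \<Rightarrow> real" where
  "diam S \<rho> = (SUP (A, B)\<in>S \<times> S. \<rho> A B)"

text \<open>
  The real suprema and infima involved are over non-empty bounded sets, because this is only
  used for bounded \<open>d\<close>.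
\<close>
definition chain_length ::
    "('a, 'm) monoid_scheme \<Rightarrow> 'a set list \<Rightarrow> ('a \<Rightarrow> 'a \<Rightarrow> real) \<Rightarrow> real" where
  "chain_length G Hs d =
     sqrt (\<Sum>i<length Hs - 1.
       (SUP g\<in>carrier G.
          diam (lcosets\<^bsub>G\<lparr>carrier := Hs ! Suc i\<rparr>\<^esub> (Hs ! i)) (coset_dist G (Hs ! i) d g))\<^sup>2)"

definition amenable_length ::
    "('a, 'm) monoid_scheme \<Rightarrow> 'a topology \<Rightarrow> ('a \<Rightarrow> 'a \<Rightarrow> real) \<Rightarrow> ennreal" where
  "amenable_length G T d = (INF Hs\<in>amenable_chains G T. ennreal (chain_length G Hs d))"

abbreviation subgroup_length ::
    "('a, 'm) monoid_scheme \<Rightarrow> 'a topology \<Rightarrow> 'a set \<Rightarrow> ('a \<Rightarrow> 'a \<Rightarrow> real) \<Rightarrow> ennreal" where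
  "subgroup_length G T H d \<equiv> amenable_length (G\<lparr>carrier := H\<rparr>) (subtopology T H) d"

definition approximants ::
    "('a, 'm) monoid_scheme \<Rightarrow> 'a topology \<Rightarrow> 'a set \<Rightarrow> 'a set \<Rightarrow> ('a set \<times> ('a \<Rightarrow> 'a \<Rightarrow> real)) set" where
  "approximants G T U F =
     {(H, d). H \<in> amenable_subgroups G T \<and> d \<in> Delta (G\<lparr>carrier := H\<rparr>) (subtopology T H) \<and>
        F \<subseteq> U <#>\<^bsub>G\<^esub> H \<and> {x \<in> H. d \<one>\<^bsub>G\<^esub> x < 1} \<subseteq> U}"

definition group_length :: "('a, 'm) monoid_scheme \<Rightarrow> 'a topology \<Rightarrow> ennreal" where
  "group_length G T =
     (SUP (U, F)\<in>{(U, F). neighbourhood_in T \<one>\<^bsub>G\<^esub> U \<and> F \<subseteq> carrier G \<and> finite F}.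
        INF (H, d)\<in>approximants G T U F. subgroup_length G T H d)"


section \<open>Directed families of sets\<close>

definition directed_by_inclusion :: "'a set set \<Rightarrow> bool" where
  "directed_by_inclusion \<H> \<longleftrightarrow>
     \<H> \<noteq> {} \<and> (\<forall>A\<in>\<H>. \<forall>B\<in>\<H>. \<exists>C\<in>\<H>. A \<subseteq> C \<and> B \<subseteq> C)"

definition liminf_directed :: "'a set set \<Rightarrow> ('a set \<Rightarrow> ennreal) \<Rightarrow> ennreal" where
  "liminf_directed \<H> f = (SUP H\<^sub>0\<in>\<H>. INF H\<in>{H \<in> \<H>. H\<^sub>0 \<subseteq> H}. f H)"

end

theory Submission
  imports Defs
begin

text \<open>
  Let \<open>H\<close> have a chain of amenable subgroups \<open>H\<^sub>0 \<le> \<dots> \<le> H\<^sub>n = H\<close> with invariant means \<open>\<mu>\<^sub>i\<close>,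
  and let \<open>P\<^sub>i f x = \<mu>\<^sub>i (h \<mapsto> f (x h))\<close>. The functions \<open>f\<^sub>i = P\<^sub>i \<dots> P\<^sub>1 f\<close> are like a reversed martingale:
  \<open>f\<^sub>i\<close> is right \<open>H\<^sub>i\<close>-invariant, and is 1-Lipschitz if \<open>f\<close> is. So its oscillation
  on a coset of \<open>H\<^bsub>i+1\<^esub>\<close> is at most the \<open>i\<close>-th diameter in the length of the chain, and adding
  up conditional variances bounds the variance of \<open>f\<close> under the left-invariant mean \<open>P\<^sub>n \<dots> P\<^sub>1\<close> by
  the squared length.

  If the length of \<open>G\<close> vanishes, orbit functions of an action on a compact space can be approximated
  by Lipschitz functions on subgroups \<open>H\<close> of arbitrarily small length, with a Lipschitz constant that
  does not depend on \<open>H\<close>. Concentration then yields almost fixed points, and compactness a fixed point.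
\<close>

section \<open>Topological groups and right uniformly continuous functions\<close>

lemma neighbourhood_in_Int:
  assumes "neighbourhood_in T x U" "neighbourhood_in T x V"
  shows "neighbourhood_in T x (U \<inter> V)"
proof -
  from assms obtain U' V' where "openin T U'" "x \<in> U'" "U' \<subseteq> U" "openin T V'" "x \<in> V'" "V' \<subseteq> V"
    unfolding neighbourhood_in_def by blast
  then have "openin T (U' \<inter> V')" "x \<in> U' \<inter> V'" "U' \<inter> V' \<subseteq> U \<inter> V" by auto
  then show ?thesis using assms unfolding neighbourhood_in_def by blast
qed

lemma neighbourhood_in_topspace: "x \<in> topspace T \<Longrightarrow> neighbourhood_in T x (topspace T)"
  unfolding neighbourhood_in_def by blast

lemma neighbourhood_in_finite_INT:
  assumes "finite I" "x \<in> topspace T" "\<And>i. i \<in> I \<Longrightarrow> neighbourhood_in T x (U i)"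
  shows "neighbourhood_in T x (topspace T \<inter> (\<Inter>i\<in>I. U i))"
  using assms
proof (induction I rule: finite_induct)
  case empty
  then show ?case by (simp add: neighbourhood_in_topspace)
next
  case (insert i I)
  have "neighbourhood_in T x (U i \<inter> (topspace T \<inter> (\<Inter>i\<in>I. U i)))"
    by (rule neighbourhood_in_Int) (use insert in auto)
  then show ?case by (simp add: Int_left_commute)
qed

lemma neighbourhood_in_subtopology:
  assumes "neighbourhood_in T x U" "x \<in> S"
  shows "neighbourhood_in (subtopology T S) x (S \<inter> U)"
proof -
  obtain V where "openin T V" "x \<in> V" "V \<subseteq> U" "U \<subseteq> topspace T"
    using assms unfolding neighbourhood_in_def by blast
  then have "openin (subtopology T S) (S \<inter> V)" "x \<in> S \<inter> V" "S \<inter> V \<subseteq> S \<inter> U" "S \<inter> U \<subseteq> topspace (subtopology T S)"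
    using assms(2) by (auto simp: openin_subtopology_Int2)
  then show ?thesis unfolding neighbourhood_in_def by blast
qed

lemma neighbourhood_in_vimage:
  assumes "continuous_map X Y f" "neighbourhood_in Y (f x) U" "x \<in> topspace X"
  shows "neighbourhood_in X x {y \<in> topspace X. f y \<in> U}"
proof -
  obtain V where "openin Y V" "f x \<in> V" "V \<subseteq> U"
    using assms unfolding neighbourhood_in_def by blast
  then have "openin X {y \<in> topspace X. f y \<in> V}" "x \<in> {y \<in> topspace X. f y \<in> V}"
    "{y \<in> topspace X. f y \<in> V} \<subseteq> {y \<in> topspace X. f y \<in> U}"
    using assms openin_continuous_map_preimage by auto
  then show ?thesis unfolding neighbourhood_in_def by blast
qed

section \<open>Continuity of the group operations, topological subgroups and the algebra
  RUCB\<close>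

context topological_group
begin

lemma one_in_topspace [simp]: "\<one> \<in> topspace T"
  by (simp add: topspace_eq)

lemma continuous_map_mult:
  assumes "continuous_map X T f" "continuous_map X T g"
  shows "continuous_map X T (\<lambda>x. f x \<otimes> g x)"
  using continuous_map_compose[OF continuous_map_pairedI[OF assms] continuous_mult]
  by (simp add: o_def)

lemma continuous_map_conjugation:
  assumes "x \<in> carrier G"
  shows "continuous_map T T (\<lambda>y. x \<otimes> y \<otimes> inv x)"
  by (intro continuous_map_mult) (use assms in \<open>auto simp: topspace_eq\<close>)

text \<open>Multiplication and inversion stay continuous in the relative topology. Everything proved
  for a topological group thus applies to the members of a chain and to the approximating
  subgroups.\<close>

lemma topological_group_subgroup:
  assumes "subgroup K G"
  shows "topological_group (G\<lparr>carrier := K\<rparr>) (subtopology T K)"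
proof -
  interpret K: subgroup K G by fact
  interpret GK: group "G\<lparr>carrier := K\<rparr>" by (rule K.subgroup_is_group) (rule is_group)
  have sub: "continuous_map (subtopology T K) T id"
    by (simp add: continuous_map_from_subtopology)
  show ?thesis
  proof unfold_locales
    show "topspace (subtopology T K) = carrier (G\<lparr>carrier := K\<rparr>)"
      using K.subset by (auto simp: topspace_eq)
    have "continuous_map (prod_topology (subtopology T K) (subtopology T K)) T (\<lambda>(x, y). x \<otimes> y)"
      unfolding prod_topology_subtopology(1) prod_topology_subtopology(2) subtopology_subtopology
      by (intro continuous_map_from_subtopology continuous_mult)
    then show "continuous_map (prod_topology (subtopology T K) (subtopology T K)) (subtopology T K)
        (\<lambda>(x, y). x \<otimes>\<^bsub>G\<lparr>carrier := K\<rparr>\<^esub> y)"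
      by (auto simp: continuous_map_in_subtopology)
    have "continuous_map (subtopology T K) (subtopology T K) (\<lambda>x. inv x)"
      using continuous_inv by (auto simp: continuous_map_in_subtopology continuous_map_from_subtopology)
    then show "continuous_map (subtopology T K) (subtopology T K) (\<lambda>x. inv\<^bsub>G\<lparr>carrier := K\<rparr>\<^esub> x)"
      by (rule continuous_map_eq) (use assms m_inv_consistent in auto)
  qed
qed

lemma RUCB_I:
  assumes "\<And>x. x \<in> carrier G \<Longrightarrow> \<bar>f x\<bar> \<le> B"
    and "\<And>\<epsilon>. \<epsilon> > 0 \<Longrightarrow> \<exists>U. neighbourhood_in T \<one> U \<and>
        (\<forall>g\<in>U. \<forall>x\<in>carrier G. \<bar>f x - f (g \<otimes> x)\<bar> \<le> \<epsilon>)"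
  shows "f \<in> RUCB G T"
  using assms unfolding RUCB_def by (auto simp: bounded_iff)

lemma RUCB_boundedE:
  assumes "f \<in> RUCB G T"
  obtains B where "B > 0" "\<And>x. x \<in> carrier G \<Longrightarrow> \<bar>f x\<bar> \<le> B"
  using assms unfolding RUCB_def bounded_pos by auto

lemma RUCB_nbhdE:
  assumes "f \<in> RUCB G T" "\<epsilon> > 0"
  obtains U where "neighbourhood_in T \<one> U" "\<And>g x. g \<in> U \<Longrightarrow> x \<in> carrier G \<Longrightarrow> \<bar>f x - f (g \<otimes> x)\<bar> \<le> \<epsilon>"
  using assms unfolding RUCB_def by blast

lemma neighbourhood_in_carrierD: "neighbourhood_in T x U \<Longrightarrow> g \<in> U \<Longrightarrow> g \<in> carrier G"
  unfolding neighbourhood_in_def topspace_eq by blast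

lemma RUCB_const: "(\<lambda>_. c) \<in> RUCB G T"
  by (rule RUCB_I[of _ "\<bar>c\<bar>"]) (auto intro!: exI[of _ "topspace T"] neighbourhood_in_topspace)

lemma RUCB_add:
  assumes "f \<in> RUCB G T" "f' \<in> RUCB G T"
  shows "(\<lambda>x. f x + f' x) \<in> RUCB G T"
proof -
  obtain B where B: "\<And>x. x \<in> carrier G \<Longrightarrow> \<bar>f x\<bar> \<le> B" using assms(1) by (rule RUCB_boundedE) blast
  obtain B' where B': "\<And>x. x \<in> carrier G \<Longrightarrow> \<bar>f' x\<bar> \<le> B'" using assms(2) by (rule RUCB_boundedE) blast
  show ?thesis
  proof (rule RUCB_I)
    show "\<bar>f x + f' x\<bar> \<le> B + B'" if "x \<in> carrier G" for x
      using B[OF that] B'[OF that] by linarith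
    fix \<epsilon> :: real assume "\<epsilon> > 0"
    then have e: "\<epsilon>/2 > 0" by simp
    obtain U where U: "neighbourhood_in T \<one> U" "\<And>g x. g \<in> U \<Longrightarrow> x \<in> carrier G \<Longrightarrow> \<bar>f x - f (g \<otimes> x)\<bar> \<le> \<epsilon>/2"
      using assms(1) e by (rule RUCB_nbhdE) blast
    obtain U' where U': "neighbourhood_in T \<one> U'" "\<And>g x. g \<in> U' \<Longrightarrow> x \<in> carrier G \<Longrightarrow> \<bar>f' x - f' (g \<otimes> x)\<bar> \<le> \<epsilon>/2"
      using assms(2) e by (rule RUCB_nbhdE) blast
    have "\<bar>f x + f' x - (f (g \<otimes> x) + f' (g \<otimes> x))\<bar> \<le> \<epsilon>" if "g \<in> U \<inter> U'" "x \<in> carrier G" for g x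
    proof -
      have "\<bar>f x - f (g \<otimes> x)\<bar> \<le> \<epsilon>/2" "\<bar>f' x - f' (g \<otimes> x)\<bar> \<le> \<epsilon>/2"
        using U(2) U'(2) that by auto
      then show ?thesis by linarith
    qed
    then show "\<exists>U. neighbourhood_in T \<one> U \<and> (\<forall>g\<in>U. \<forall>x\<in>carrier G. \<bar>f x + f' x - (f (g \<otimes> x) + f' (g \<otimes> x))\<bar> \<le> \<epsilon>)"
      using neighbourhood_in_Int[OF U(1) U'(1)] by blast
  qed
qed

lemma RUCB_mult:
  assumes "f \<in> RUCB G T" "f' \<in> RUCB G T"
  shows "(\<lambda>x. f x * f' x) \<in> RUCB G T"
proof -
  obtain B where B: "B > 0" "\<And>x. x \<in> carrier G \<Longrightarrow> \<bar>f x\<bar> \<le> B" using assms(1) by (rule RUCB_boundedE) blast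
  obtain B' where B': "B' > 0" "\<And>x. x \<in> carrier G \<Longrightarrow> \<bar>f' x\<bar> \<le> B'" using assms(2) by (rule RUCB_boundedE) blast
  show ?thesis
  proof (rule RUCB_I)
    show "\<bar>f x * f' x\<bar> \<le> B * B'" if "x \<in> carrier G" for x
      unfolding abs_mult using B(2)[OF that] B'(2)[OF that] B(1) by (intro mult_mono) auto
    fix \<epsilon> :: real assume "\<epsilon> > 0"
    then have e: "\<epsilon>/(2*B') > 0" "\<epsilon>/(2*B) > 0" using B B' by simp_all
    obtain U where U: "neighbourhood_in T \<one> U" "\<And>g x. g \<in> U \<Longrightarrow> x \<in> carrier G \<Longrightarrow> \<bar>f x - f (g \<otimes> x)\<bar> \<le> \<epsilon>/(2*B')"
      using assms(1) e(1) by (rule RUCB_nbhdE) blast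
    obtain U' where U': "neighbourhood_in T \<one> U'" "\<And>g x. g \<in> U' \<Longrightarrow> x \<in> carrier G \<Longrightarrow> \<bar>f' x - f' (g \<otimes> x)\<bar> \<le> \<epsilon>/(2*B)"
      using assms(2) e(2) by (rule RUCB_nbhdE) blast
    have "\<bar>f x * f' x - f (g \<otimes> x) * f' (g \<otimes> x)\<bar> \<le> \<epsilon>" if g: "g \<in> U \<inter> U'" and x: "x \<in> carrier G" for g x
    proof -
      have gx: "g \<otimes> x \<in> carrier G" using g x U(1) neighbourhood_in_carrierD by auto
      have "f x * f' x - f (g \<otimes> x) * f' (g \<otimes> x) = (f x - f (g \<otimes> x)) * f' x + f (g \<otimes> x) * (f' x - f' (g \<otimes> x))"
        by (simp add: algebra_simps)
      also have "\<bar>\<dots>\<bar> \<le> \<bar>f x - f (g \<otimes> x)\<bar> * \<bar>f' x\<bar> + \<bar>f (g \<otimes> x)\<bar> * \<bar>f' x - f' (g \<otimes> x)\<bar>"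
        by (metis abs_mult abs_triangle_ineq)
      also have "\<dots> \<le> \<epsilon>/(2*B') * B' + B * (\<epsilon>/(2*B))"
        using U(2)[of g x] U'(2)[of g x] B'(2)[OF x] B(2)[OF gx] g x e B(1) B'(1)
        by (intro add_mono mult_mono) auto
      also have "\<dots> = \<epsilon>" using B(1) B'(1) by (simp add: field_simps)
      finally show ?thesis .
    qed
    then show "\<exists>U. neighbourhood_in T \<one> U \<and> (\<forall>g\<in>U. \<forall>x\<in>carrier G. \<bar>f x * f' x - f (g \<otimes> x) * f' (g \<otimes> x)\<bar> \<le> \<epsilon>)"
      using neighbourhood_in_Int[OF U(1) U'(1)] by blast
  qed
qed

lemma RUCB_cmult: "f \<in> RUCB G T \<Longrightarrow> (\<lambda>x. c * f x) \<in> RUCB G T"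
  by (rule RUCB_mult[OF RUCB_const])

lemma RUCB_diff_const: "f \<in> RUCB G T \<Longrightarrow> (\<lambda>x. f x - c) \<in> RUCB G T"
  using RUCB_add[OF _ RUCB_const[of "-c"]] by simp

lemma RUCB_power2: "f \<in> RUCB G T \<Longrightarrow> (\<lambda>x. (f x)\<^sup>2) \<in> RUCB G T"
  unfolding power2_eq_square by (rule RUCB_mult)

lemma RUCB_sum: "(\<And>i. i \<in> I \<Longrightarrow> f i \<in> RUCB G T) \<Longrightarrow> (\<lambda>x. \<Sum>i\<in>I. f i x) \<in> RUCB G T"
  by (induction I rule: infinite_finite_induct) (auto intro: RUCB_const RUCB_add)

text \<open>Since \<open>x \<otimes> (g \<otimes> h) = (x \<otimes> g \<otimes> inv x) \<otimes> (x
  \<otimes> h)\<close>, moving \<open>h\<close> by \<open>g\<close> moves the argument of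
  \<open>f\<close> by a conjugate of \<open>g\<close>, and conjugation by the fixed \<open>x\<close>
  is continuous at the identity. This is what allows \<open>f\<close> to be averaged over a coset of
  a subgroup with a mean of that subgroup.\<close>

lemma RUCB_translate_subgroup:
  assumes f: "f \<in> RUCB G T" and K: "subgroup K G" and x: "x \<in> carrier G"
  shows "(\<lambda>h. f (x \<otimes> h)) \<in> RUCB (G\<lparr>carrier := K\<rparr>) (subtopology T K)"
proof -
  interpret K: subgroup K G by fact
  interpret GK: topological_group "G\<lparr>carrier := K\<rparr>" "subtopology T K"
    by (rule topological_group_subgroup) fact
  obtain B where B: "\<And>x. x \<in> carrier G \<Longrightarrow> \<bar>f x\<bar> \<le> B" using f by (rule RUCB_boundedE) blast
  show ?thesis
  proof (rule GK.RUCB_I)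
    show "\<bar>f (x \<otimes> h)\<bar> \<le> B" if "h \<in> carrier (G\<lparr>carrier := K\<rparr>)" for h
      using that x K.mem_carrier by (auto intro!: B)
    fix \<epsilon> :: real assume "\<epsilon> > 0"
    with f obtain U where U: "neighbourhood_in T \<one> U" "\<And>g x. g \<in> U \<Longrightarrow> x \<in> carrier G \<Longrightarrow> \<bar>f x - f (g \<otimes> x)\<bar> \<le> \<epsilon>"
      by (rule RUCB_nbhdE) blast
    let ?V = "{y \<in> topspace T. x \<otimes> y \<otimes> inv x \<in> U}"
    have "neighbourhood_in T \<one> ?V"
      by (rule neighbourhood_in_vimage[OF continuous_map_conjugation]) (use x U in auto)
    then have "neighbourhood_in (subtopology T K) \<one>\<^bsub>G\<lparr>carrier := K\<rparr>\<^esub> (K \<inter> ?V)"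
      by (simp add: neighbourhood_in_subtopology)
    moreover have "\<bar>f (x \<otimes> h) - f (x \<otimes> (g \<otimes>\<^bsub>G\<lparr>carrier := K\<rparr>\<^esub> h))\<bar> \<le> \<epsilon>"
      if g: "g \<in> K \<inter> ?V" and h: "h \<in> carrier (G\<lparr>carrier := K\<rparr>)" for g h
    proof -
      have "g \<in> carrier G" "h \<in> carrier G" using g h K.mem_carrier by auto
      then have "x \<otimes> (g \<otimes> h) = (x \<otimes> g \<otimes> inv x) \<otimes> (x \<otimes> h)"
        using x by (simp add: m_assoc) (simp flip: m_assoc)
      then show ?thesis using U(2)[of "x \<otimes> g \<otimes> inv x" "x \<otimes> h"] g x \<open>h \<in> carrier G\<close> by auto
    qed
    ultimately show "\<exists>U. neighbourhood_in (subtopology T K) \<one>\<^bsub>G\<lparr>carrier := K\<rparr>\<^esub> U \<and>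
       (\<forall>g\<in>U. \<forall>h\<in>carrier (G\<lparr>carrier := K\<rparr>). \<bar>f (x \<otimes> h) - f (x \<otimes> (g \<otimes>\<^bsub>G\<lparr>carrier := K\<rparr>\<^esub> h))\<bar> \<le> \<epsilon>)"
      by blast
  qed
qed

lemma RUCB_translate: "f \<in> RUCB G T \<Longrightarrow> x \<in> carrier G \<Longrightarrow> (\<lambda>h. f (x \<otimes> h)) \<in> RUCB G T"
  using RUCB_translate_subgroup[OF _ subgroup_self] subtopology_topspace[of T] by (simp add: topspace_eq)

end

section \<open>Invariant means and their variance\<close>

locale invariant_mean = topological_group +
  fixes \<mu> :: "('a \<Rightarrow> real) \<Rightarrow> real"
  assumes add: "f \<in> RUCB G T \<Longrightarrow> f' \<in> RUCB G T \<Longrightarrow> \<mu> (\<lambda>x. f x + f' x) = \<mu> f + \<mu> f'"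
    and cmult: "f \<in> RUCB G T \<Longrightarrow> \<mu> (\<lambda>x. c * f x) = c * \<mu> f"
    and nonneg: "f \<in> RUCB G T \<Longrightarrow> (\<And>x. x \<in> carrier G \<Longrightarrow> 0 \<le> f x) \<Longrightarrow> 0 \<le> \<mu> f"
    and one: "\<mu> (\<lambda>_. 1) = 1"
    and invariant: "f \<in> RUCB G T \<Longrightarrow> g \<in> carrier G \<Longrightarrow> \<mu> (\<lambda>x. f (g \<otimes> x)) = \<mu> f"
begin

lemma const: "\<mu> (\<lambda>_. c) = c"
  using cmult[OF RUCB_const[of 1], of c] one by simp

lemma mono:
  assumes "f \<in> RUCB G T" "f' \<in> RUCB G T" "\<And>x. x \<in> carrier G \<Longrightarrow> f x \<le> f' x"
  shows "\<mu> f \<le> \<mu> f'"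
proof -
  have "0 \<le> \<mu> (\<lambda>x. f' x + (-1) * f x)"
    by (rule nonneg[OF RUCB_add[OF _ RUCB_cmult]]) (use assms in auto)
  also have "\<dots> = \<mu> f' + (-1) * \<mu> f"
    by (simp only: add[OF assms(2) RUCB_cmult[OF assms(1)]] cmult[OF assms(1)])
  finally show ?thesis by simp
qed

text \<open>A mean is a functional on total functions, so values off the carrier might matter;
  positivity excludes this. Functions on a subgroup often have to be rewritten where only equality
  on that subgroup is known.\<close>

lemma cong:
  assumes "f \<in> RUCB G T" "f' \<in> RUCB G T" "\<And>x. x \<in> carrier G \<Longrightarrow> f x = f' x"
  shows "\<mu> f = \<mu> f'"
  by (intro antisym mono) (use assms in auto)

lemma le_const: "f \<in> RUCB G T \<Longrightarrow> (\<And>x. x \<in> carrier G \<Longrightarrow> f x \<le> c) \<Longrightarrow> \<mu> f \<le> c"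
  using mono[of f "\<lambda>_. c"] by (simp add: RUCB_const const)

lemma ge_const: "f \<in> RUCB G T \<Longrightarrow> (\<And>x. x \<in> carrier G \<Longrightarrow> c \<le> f x) \<Longrightarrow> c \<le> \<mu> f"
  using mono[of "\<lambda>_. c" f] by (simp add: RUCB_const const)

lemma add_const: "f \<in> RUCB G T \<Longrightarrow> \<mu> (\<lambda>x. f x + c) = \<mu> f + c"
  using add[OF _ RUCB_const] by (simp add: const)

lemma abs_diff_le:
  assumes "f \<in> RUCB G T" "f' \<in> RUCB G T" "\<And>x. x \<in> carrier G \<Longrightarrow> \<bar>f x - f' x\<bar> \<le> c"
  shows "\<bar>\<mu> f - \<mu> f'\<bar> \<le> c"
proof -
  have "\<mu> f \<le> \<mu> (\<lambda>x. f' x + c)"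
    by (rule mono) (use assms in \<open>force intro: RUCB_add RUCB_const\<close>)+
  moreover have "\<mu> f' \<le> \<mu> (\<lambda>x. f x + c)"
    by (rule mono) (use assms in \<open>force intro: RUCB_add RUCB_const\<close>)+
  ultimately show ?thesis using assms by (simp add: add_const)
qed

lemma sum: "(\<And>i. i \<in> I \<Longrightarrow> f i \<in> RUCB G T) \<Longrightarrow> \<mu> (\<lambda>x. \<Sum>i\<in>I. f i x) = (\<Sum>i\<in>I. \<mu> (f i))"
  by (induction I rule: infinite_finite_induct) (auto simp: const add RUCB_sum)

text \<open>With \<open>c = \<mu> f\<close> this is the identity that the variance is the mean
  square minus the squared mean.\<close>

lemma square_deviation:
  assumes f: "f \<in> RUCB G T"
  shows "\<mu> (\<lambda>x. (f x - c)\<^sup>2) = \<mu> (\<lambda>x. (f x)\<^sup>2) - 2 * c * \<mu> f + c\<^sup>2"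
proof -
  have "(\<lambda>x. (f x - c)\<^sup>2) = (\<lambda>x. ((f x)\<^sup>2 + (- 2 * c) * f x) + c\<^sup>2)"
    by (simp add: power2_eq_square algebra_simps)
  then have "\<mu> (\<lambda>x. (f x - c)\<^sup>2) = \<mu> (\<lambda>x. (f x)\<^sup>2 + (- 2 * c) * f x) + c\<^sup>2"
    by (simp only:) (intro add_const RUCB_add RUCB_cmult RUCB_power2 f)
  also have "\<mu> (\<lambda>x. (f x)\<^sup>2 + (- 2 * c) * f x) = \<mu> (\<lambda>x. (f x)\<^sup>2) + (- 2 * c) * \<mu> f"
    by (simp only: add[OF RUCB_power2[OF f] RUCB_cmult[OF f]] cmult[OF f])
  finally show ?thesis by simp
qed

text \<open>The mean lies between any lower and any upper bound of \<open>f\<close>, hence within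
  \<open>D\<close> of every value. So each squared deviation from the mean is at most
  \<open>D\<^sup>2\<close>, and the mean of these deviations is the variance.\<close>

lemma square_le_of_oscillation:
  assumes f: "f \<in> RUCB G T"
    and osc: "\<And>x y. x \<in> carrier G \<Longrightarrow> y \<in> carrier G \<Longrightarrow> f x - f y \<le> D"
  shows "\<mu> (\<lambda>x. (f x)\<^sup>2) \<le> (\<mu> f)\<^sup>2 + D\<^sup>2"
proof -
  have "\<bar>f x - \<mu> f\<bar> \<le> D" if x: "x \<in> carrier G" for x
  proof -
    have "\<mu> f \<le> f x + D"
      using osc x by (intro le_const f) (simp add: algebra_simps)
    moreover have "f x - D \<le> \<mu> f"
      using osc x by (intro ge_const f) (simp add: algebra_simps)
    ultimately show ?thesis by linarith
  qed
  then have "(f x - \<mu> f)\<^sup>2 \<le> D\<^sup>2" if "x \<in> carrier G" for x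
    using that by (metis abs_ge_zero power2_abs power_mono)
  then have "\<mu> (\<lambda>x. (f x - \<mu> f)\<^sup>2) \<le> D\<^sup>2"
    by (intro le_const RUCB_power2 RUCB_diff_const f)
  then show ?thesis unfolding square_deviation[OF f] by (simp add: power2_eq_square)
qed

end

lemma (in topological_group) amenable_iff_invariant_mean:
  "amenable G T \<longleftrightarrow> (\<exists>\<mu>. invariant_mean G T \<mu>)"
  unfolding amenable_def invariant_mean_def invariant_mean_axioms_def
  using topological_group_axioms by (intro iff_exI) blast


section \<open>The variance of an iterated mean\<close>

text \<open>The inequality is one-sided, but it is required for all ordered pairs; for symmetric
  \<open>d\<close> it bounds the absolute difference.\<close>

definition lipschitz_dist :: "'a set \<Rightarrow> ('a \<Rightarrow> 'a \<Rightarrow> real) \<Rightarrow> ('a \<Rightarrow> real) \<Rightarrow> bool" where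
  "lipschitz_dist M d f \<longleftrightarrow> (\<forall>x\<in>M. \<forall>y\<in>M. f x - f y \<le> d x y)"

text \<open>An analogue of conditional expectation: \<open>A\<close> sends functions to right
  \<open>K\<close>-invariant ones, commutes with left translations, and has conditional variance at
  most \<open>s\<close> on 1-Lipschitz functions. The list of properties is chosen so that it
  survives a further averaging over a larger subgroup. All identities are claimed on the carrier
  only.\<close>

locale averaging = topological_group +
  fixes K :: "'a set" and d :: "'a \<Rightarrow> 'a \<Rightarrow> real" and s :: real and A :: "('a \<Rightarrow> real) \<Rightarrow> 'a \<Rightarrow> real"
  assumes RUCB: "f \<in> RUCB G T \<Longrightarrow> A f \<in> RUCB G T"
    and add: "f \<in> RUCB G T \<Longrightarrow> f' \<in> RUCB G T \<Longrightarrow> x \<in> carrier G \<Longrightarrow> A (\<lambda>y. f y + f' y) x = A f x + A f' x"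
    and cmult: "f \<in> RUCB G T \<Longrightarrow> x \<in> carrier G \<Longrightarrow> A (\<lambda>y. c * f y) x = c * A f x"
    and nonneg: "f \<in> RUCB G T \<Longrightarrow> (\<And>x. x \<in> carrier G \<Longrightarrow> 0 \<le> f x) \<Longrightarrow> x \<in> carrier G \<Longrightarrow> 0 \<le> A f x"
    and one: "x \<in> carrier G \<Longrightarrow> A (\<lambda>_. 1) x = 1"
    and translate: "f \<in> RUCB G T \<Longrightarrow> g \<in> carrier G \<Longrightarrow> x \<in> carrier G \<Longrightarrow> A (\<lambda>y. f (g \<otimes> y)) x = A f (g \<otimes> x)"
    and right_invariant: "f \<in> RUCB G T \<Longrightarrow> x \<in> carrier G \<Longrightarrow> k \<in> K \<Longrightarrow> A f (x \<otimes> k) = A f x"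
    and lipschitz: "f \<in> RUCB G T \<Longrightarrow> lipschitz_dist (carrier G) d f \<Longrightarrow> lipschitz_dist (carrier G) d (A f)"
    and variance: "f \<in> RUCB G T \<Longrightarrow> lipschitz_dist (carrier G) d f \<Longrightarrow> x \<in> carrier G \<Longrightarrow>
      A (\<lambda>y. (f y)\<^sup>2) x \<le> (A f x)\<^sup>2 + s"
begin

text \<open>The new operator averages \<open>A f\<close> over the coset of \<open>x\<close> modulo
  \<open>L\<close>. The variance bound is the law of total variance: the variance inside
  \<open>A\<close> contributes \<open>s\<close>, and \<open>A f\<close>, being Lipschitz and right
  \<open>K\<close>-invariant, oscillates by at most \<open>D\<close> on each coset of
  \<open>L\<close>, which contributes \<open>D\<^sup>2\<close>.\<close>

lemma extend:
  assumes L: "subgroup L G" and \<mu>: "invariant_mean (G\<lparr>carrier := L\<rparr>) (subtopology T L) \<mu>"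
    and d: "Defs.right_invariant G d"
    and osc: "\<And>f x a b. \<lbrakk>f \<in> RUCB G T; lipschitz_dist (carrier G) d f;
      \<And>x k. x \<in> carrier G \<Longrightarrow> k \<in> K \<Longrightarrow> f (x \<otimes> k) = f x; x \<in> carrier G; a \<in> L; b \<in> L\<rbrakk>
      \<Longrightarrow> f (x \<otimes> a) - f (x \<otimes> b) \<le> D"
  shows "averaging G T L d (s + D\<^sup>2) (\<lambda>f x. \<mu> (\<lambda>h. A f (x \<otimes> h)))"
proof -
  interpret L: subgroup L G by fact
  interpret M: invariant_mean "G\<lparr>carrier := L\<rparr>" "subtopology T L" \<mu> by fact
  note tr = RUCB_translate_subgroup[OF _ L]
  note mem = L.mem_carrier
  show ?thesis
  proof unfold_locales
    fix f assume f: "f \<in> RUCB G T"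
    note Af = RUCB[OF f]
    note trf = tr[OF Af]
    \<comment> \<open>Left translation by \<open>g\<close> commutes with right multiplication by
      \<open>h\<close>, so a neighbourhood that works for \<open>A f\<close> works for its
      average.\<close>
    show "(\<lambda>x. \<mu> (\<lambda>h. A f (x \<otimes> h))) \<in> RUCB G T"
    proof -
      obtain B where B: "\<And>x. x \<in> carrier G \<Longrightarrow> \<bar>A f x\<bar> \<le> B" using Af by (rule RUCB_boundedE) blast
      show ?thesis
      proof (rule RUCB_I)
        show "\<bar>\<mu> (\<lambda>h. A f (x \<otimes> h))\<bar> \<le> B" if "x \<in> carrier G" for x
          using M.abs_diff_le[OF trf[OF that] M.RUCB_const[of 0], of B] B that mem by (simp add: M.const)
        fix \<epsilon> :: real assume "\<epsilon> > 0"
        with Af obtain U where U: "neighbourhood_in T \<one> U" "\<And>g x. g \<in> U \<Longrightarrow> x \<in> carrier G \<Longrightarrow> \<bar>A f x - A f (g \<otimes> x)\<bar> \<le> \<epsilon>"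
          by (rule RUCB_nbhdE) blast
        have "\<bar>\<mu> (\<lambda>h. A f (x \<otimes> h)) - \<mu> (\<lambda>h. A f (g \<otimes> x \<otimes> h))\<bar> \<le> \<epsilon>"
          if g: "g \<in> U" and x: "x \<in> carrier G" for g x
        proof -
          have gc: "g \<in> carrier G" using U(1) g by (rule neighbourhood_in_carrierD)
          show ?thesis
          proof (rule M.abs_diff_le[OF trf trf])
            fix h assume "h \<in> carrier (G\<lparr>carrier := L\<rparr>)"
            then have h: "h \<in> carrier G" using mem by simp
            show "\<bar>A f (x \<otimes> h) - A f (g \<otimes> x \<otimes> h)\<bar> \<le> \<epsilon>"
              using U(2)[OF g, of "x \<otimes> h"] x h gc by (simp add: m_assoc)
          qed (use x gc in auto)
        qed
        then show "\<exists>U. neighbourhood_in T \<one> U \<and> (\<forall>g\<in>U. \<forall>x\<in>carrier G. 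
            \<bar>\<mu> (\<lambda>h. A f (x \<otimes> h)) - \<mu> (\<lambda>h. A f (g \<otimes> x \<otimes> h))\<bar> \<le> \<epsilon>)"
          using U(1) by blast
      qed
    qed
    show "lipschitz_dist (carrier G) d (\<lambda>x. \<mu> (\<lambda>h. A f (x \<otimes> h)))"
      if lip: "lipschitz_dist (carrier G) d f"
      unfolding lipschitz_dist_def
    proof (intro ballI)
      fix x y assume x: "x \<in> carrier G" and y: "y \<in> carrier G"
      have "\<mu> (\<lambda>h. A f (x \<otimes> h)) \<le> \<mu> (\<lambda>h. A f (y \<otimes> h) + d x y)"
      proof (rule M.mono[OF trf[OF x] M.RUCB_add[OF trf[OF y] M.RUCB_const]])
        fix h assume "h \<in> carrier (G\<lparr>carrier := L\<rparr>)"
        then have h: "h \<in> carrier G" using mem by simp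
        have "A f (x \<otimes> h) - A f (y \<otimes> h) \<le> d (x \<otimes> h) (y \<otimes> h)"
          using lipschitz[OF f lip] x y h unfolding lipschitz_dist_def by blast
        \<comment> \<open>Right invariance removes the common factor \<open>h\<close>, so the bound
          is constant on \<open>L\<close> and passes through the mean.\<close>
        also have "\<dots> = d x y" using d x y h unfolding right_invariant_def by blast
        finally show "A f (x \<otimes> h) \<le> A f (y \<otimes> h) + d x y" by simp
      qed
      also have "\<dots> = \<mu> (\<lambda>h. A f (y \<otimes> h)) + d x y" by (intro M.add_const trf y)
      finally show "\<mu> (\<lambda>h. A f (x \<otimes> h)) - \<mu> (\<lambda>h. A f (y \<otimes> h)) \<le> d x y" by simp
    qed
    fix x assume x: "x \<in> carrier G"
    have xh: "x \<otimes> h \<in> carrier G" if "h \<in> L" for h using x mem[OF that] by simp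
    show "\<mu> (\<lambda>h. A (\<lambda>y. f y + f' y) (x \<otimes> h)) = \<mu> (\<lambda>h. A f (x \<otimes> h)) + \<mu> (\<lambda>h. A f' (x \<otimes> h))"
      if f': "f' \<in> RUCB G T" for f'
    proof -
      have "\<mu> (\<lambda>h. A (\<lambda>y. f y + f' y) (x \<otimes> h)) = \<mu> (\<lambda>h. A f (x \<otimes> h) + A f' (x \<otimes> h))"
        using f f' x xh by (intro M.cong M.RUCB_add tr RUCB RUCB_add) (auto simp: add)
      also have "\<dots> = \<mu> (\<lambda>h. A f (x \<otimes> h)) + \<mu> (\<lambda>h. A f' (x \<otimes> h))"
        using f f' x by (intro M.add tr RUCB)
      finally show ?thesis .
    qed
    show "\<mu> (\<lambda>h. A (\<lambda>y. c * f y) (x \<otimes> h)) = c * \<mu> (\<lambda>h. A f (x \<otimes> h))" for c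
    proof -
      have "\<mu> (\<lambda>h. A (\<lambda>y. c * f y) (x \<otimes> h)) = \<mu> (\<lambda>h. c * A f (x \<otimes> h))"
        using f x xh by (intro M.cong M.RUCB_cmult tr RUCB RUCB_cmult) (auto simp: cmult)
      also have "\<dots> = c * \<mu> (\<lambda>h. A f (x \<otimes> h))"
        using f x by (intro M.cmult tr RUCB)
      finally show ?thesis .
    qed
    show "0 \<le> \<mu> (\<lambda>h. A f (x \<otimes> h))" if "\<And>x. x \<in> carrier G \<Longrightarrow> 0 \<le> f x"
      using f x xh that by (intro M.nonneg tr RUCB) (auto intro: nonneg)
    show "\<mu> (\<lambda>h. A (\<lambda>y. f (g \<otimes> y)) (x \<otimes> h)) = \<mu> (\<lambda>h. A f (g \<otimes> x \<otimes> h))" if g: "g \<in> carrier G" for g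
      using f x g xh mem by (intro M.cong tr RUCB RUCB_translate) (auto simp: translate m_assoc)
    \<comment> \<open>Right translation of \<open>x\<close> by \<open>k\<close> is left translation
      of the integration variable \<open>h\<close>, under which the mean on \<open>L\<close> is
      invariant.\<close>
    show "\<mu> (\<lambda>h. A f (x \<otimes> k \<otimes> h)) = \<mu> (\<lambda>h. A f (x \<otimes> h))" if k: "k \<in> L" for k
    proof -
      have "\<mu> (\<lambda>h. A f (x \<otimes> k \<otimes> h)) = \<mu> (\<lambda>h. A f (x \<otimes> (k \<otimes>\<^bsub>G\<lparr>carrier := L\<rparr>\<^esub> h)))"
      proof (rule M.cong)
        show "(\<lambda>h. A f (x \<otimes> (k \<otimes>\<^bsub>G\<lparr>carrier := L\<rparr>\<^esub> h))) \<in> RUCB (G\<lparr>carrier := L\<rparr>) (subtopology T L)"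
          using M.RUCB_translate[OF trf[OF x], of k] k by simp
      qed (use f x k mem in \<open>auto intro: tr RUCB simp: m_assoc\<close>)
      also have "\<dots> = \<mu> (\<lambda>h. A f (x \<otimes> h))"
        using M.invariant[OF trf[OF x], of k] k by simp
      finally show ?thesis .
    qed
    assume lip: "lipschitz_dist (carrier G) d f"
    note lipA = lipschitz[OF f lip]
    have "\<mu> (\<lambda>h. A (\<lambda>y. (f y)\<^sup>2) (x \<otimes> h)) \<le> \<mu> (\<lambda>h. (A f (x \<otimes> h))\<^sup>2 + s)"
      using f x xh lip by (intro M.mono M.RUCB_add M.RUCB_const M.RUCB_power2 tr RUCB RUCB_power2) (auto intro: variance)
    also have "\<dots> = \<mu> (\<lambda>h. (A f (x \<otimes> h))\<^sup>2) + s"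
      by (intro M.add_const M.RUCB_power2 trf x)
    also have "\<mu> (\<lambda>h. (A f (x \<otimes> h))\<^sup>2) \<le> (\<mu> (\<lambda>h. A f (x \<otimes> h)))\<^sup>2 + D\<^sup>2"
      using x right_invariant[OF f] by (intro M.square_le_of_oscillation trf osc Af lipA) auto
    finally show "\<mu> (\<lambda>h. A (\<lambda>y. (f y)\<^sup>2) (x \<otimes> h)) \<le> (\<mu> (\<lambda>h. A f (x \<otimes> h)))\<^sup>2 + (s + D\<^sup>2)" by simp
  next
    fix x assume x: "x \<in> carrier G"
    have "\<mu> (\<lambda>h. A (\<lambda>_. 1) (x \<otimes> h)) = \<mu> (\<lambda>_. 1)"
      using x mem by (intro M.cong M.RUCB_const tr RUCB RUCB_const) (auto simp: one)
    then show "\<mu> (\<lambda>h. A (\<lambda>_. 1) (x \<otimes> h)) = 1" by (simp add: M.one)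
  qed
qed

end

section \<open>Coset diameters along a chain and the resulting mean\<close>

lemma lcosets_carrier_update: "lcosets\<^bsub>G\<lparr>carrier := L\<rparr>\<^esub> K = (\<lambda>a. a <#\<^bsub>G\<^esub> K) ` L"
  by (auto simp: LCOSETS_def l_coset_def)

text \<open>A term of the sum in \<open>chain_length\<close> before squaring, for consecutive
  members \<open>K\<close> and \<open>L\<close> of the chain.\<close>

definition (in topological_group) chain_step :: "('a \<Rightarrow> 'a \<Rightarrow> real) \<Rightarrow> 'a set \<Rightarrow> 'a set \<Rightarrow> real" where
  "chain_step d K L =
    (SUP g\<in>carrier G. diam (lcosets\<^bsub>G\<lparr>carrier := L\<rparr>\<^esub> K) (coset_dist G K d g))"

context topological_group
begin

text \<open>The distance is one of the values over which the two suprema are taken. Real suprema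
  dominate their members only for sets bounded above, so a bound \<open>B\<close> of
  \<open>d\<close> is carried along; the coset distances obey it because the identity is an
  admissible \<open>h\<close> in the infimum.\<close>

lemma dist_le_chain_step:
  assumes d: "pseudo_metric_on (carrier G) d" "bounded_dist_on (carrier G) d" "right_invariant G d"
    and K: "subgroup K G" and L: "subgroup L G"
    and x: "x \<in> carrier G" and a: "a \<in> L" and b: "b \<in> L"
  shows "(INF h\<in>K. d (x \<otimes> a) (x \<otimes> b \<otimes> h)) \<le> chain_step d K L"
proof -
  interpret K: subgroup K G by fact
  interpret L: subgroup L G by fact
  obtain B where "\<And>p. p \<in> carrier G \<times> carrier G \<Longrightarrow> \<bar>case p of (x, y) \<Rightarrow> d x y\<bar> \<le> B"
    using d(2) unfolding bounded_dist_on_def bounded_iff by auto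
  then have B: "d x y \<le> B" if "x \<in> carrier G" "y \<in> carrier G" for x y
    using that by fastforce
  let ?C = "lcosets\<^bsub>G\<lparr>carrier := L\<rparr>\<^esub> K"
  note C = lcosets_carrier_update
  have cd: "coset_dist G K d g (u <# K) (v <# K) = (INF h\<in>K. d (g \<otimes> u) (g \<otimes> v \<otimes> h))"
    if "g \<in> carrier G" "u \<in> L" "v \<in> L" for g u v
    using that d(3) K L.mem_carrier by (intro coset_dist_l_coset is_group)
  have le: "(INF h\<in>K. d (g \<otimes> u) (g \<otimes> v \<otimes> h)) \<le> B"
    if "g \<in> carrier G" "u \<in> L" "v \<in> L" for g u v
  proof -
    have "(INF h\<in>K. d (g \<otimes> u) (g \<otimes> v \<otimes> h)) \<le> d (g \<otimes> u) (g \<otimes> v \<otimes> \<one>)"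
    proof (rule cINF_lower)
      show "bdd_below ((\<lambda>h. d (g \<otimes> u) (g \<otimes> v \<otimes> h)) ` K)"
        using that d(1) K.mem_carrier L.mem_carrier
        by (intro bdd_belowI2[of _ 0]) (auto simp: pseudo_metric_on_def)
    qed auto
    also have "\<dots> \<le> B" using that L.mem_carrier by (intro B) auto
    finally show ?thesis .
  qed
  have bdd: "bdd_above ((\<lambda>(A, B). coset_dist G K d g A B) ` (?C \<times> ?C))" if "g \<in> carrier G" for g
    unfolding C using that by (auto intro!: bdd_aboveI[of _ B] simp: cd le)
  have diam: "coset_dist G K d g (u <# K) (v <# K) \<le> diam ?C (coset_dist G K d g)"
    if "g \<in> carrier G" "u \<in> L" "v \<in> L" for g u v
  proof -
    have "(u <# K, v <# K) \<in> ?C \<times> ?C" unfolding C using that by blast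
    from cSUP_upper[OF this bdd[OF that(1)]] show ?thesis unfolding diam_def by simp
  qed
  have diam_le: "diam ?C (coset_dist G K d g) \<le> B" if "g \<in> carrier G" for g
    unfolding diam_def
  proof (rule cSUP_least)
    show "?C \<times> ?C \<noteq> {}" unfolding C using L.one_closed by blast
    show "(case p of (A, B) \<Rightarrow> coset_dist G K d g A B) \<le> B" if "p \<in> ?C \<times> ?C" for p
      using that \<open>g \<in> carrier G\<close> unfolding C by (auto simp: cd le)
  qed
  have "(INF h\<in>K. d (x \<otimes> a) (x \<otimes> b \<otimes> h)) \<le> diam ?C (coset_dist G K d x)"
    using diam[OF x a b] cd[OF x a b] by simp
  also have "\<dots> \<le> chain_step d K L"
    unfolding chain_step_def
    by (rule cSUP_upper[OF x]) (use diam_le in \<open>auto intro!: bdd_aboveI[of _ B]\<close>)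
  finally show ?thesis .
qed

text \<open>Replacing \<open>x \<otimes> b\<close> by \<open>x \<otimes> b \<otimes> h\<close> with
  \<open>h\<close> in \<open>K\<close> leaves \<open>f\<close> unchanged, so the Lipschitz bound may
  be optimised over \<open>h\<close>, which turns it into the coset distance.\<close>

lemma chain_oscillation:
  assumes d: "pseudo_metric_on (carrier G) d" "bounded_dist_on (carrier G) d" "right_invariant G d"
    and K: "subgroup K G" and L: "subgroup L G"
    and f: "lipschitz_dist (carrier G) d f" "\<And>x k. x \<in> carrier G \<Longrightarrow> k \<in> K \<Longrightarrow> f (x \<otimes> k) = f x"
    and x: "x \<in> carrier G" and a: "a \<in> L" and b: "b \<in> L"
  shows "f (x \<otimes> a) - f (x \<otimes> b) \<le> chain_step d K L"
proof -
  interpret K: subgroup K G by fact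
  interpret L: subgroup L G by fact
  have ab: "x \<otimes> a \<in> carrier G" "x \<otimes> b \<in> carrier G" using x a b L.mem_carrier by auto
  have "f (x \<otimes> a) - f (x \<otimes> b) \<le> (INF h\<in>K. d (x \<otimes> a) (x \<otimes> b \<otimes> h))"
  proof (rule cINF_greatest)
    show "K \<noteq> {}" using K.one_closed by blast
    fix h assume h: "h \<in> K"
    have "f (x \<otimes> a) - f (x \<otimes> b \<otimes> h) \<le> d (x \<otimes> a) (x \<otimes> b \<otimes> h)"
      using f(1) ab h K.mem_carrier unfolding lipschitz_dist_def by auto
    then show "f (x \<otimes> a) - f (x \<otimes> b) \<le> d (x \<otimes> a) (x \<otimes> b \<otimes> h)"
      using f(2)[OF ab(2) h] by simp
  qed
  also have "\<dots> \<le> chain_step d K L" by (rule dist_le_chain_step) fact+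
  finally show ?thesis .
qed

lemma averaging_along_chain:
  assumes Hs: "Hs \<in> amenable_chains G T"
    and d: "pseudo_metric_on (carrier G) d" "bounded_dist_on (carrier G) d" "right_invariant G d"
    and i: "i < length Hs"
  shows "\<exists>A. averaging G T (Hs ! i) d (\<Sum>j<i. (chain_step d (Hs ! j) (Hs ! Suc j))\<^sup>2) A"
  using i
proof (induction i)
  case 0
  have H0: "Hs ! 0 = {\<one>}" using Hs by (auto simp: amenable_chains_def hd_conv_nth)
  \<comment> \<open>The identity operator starts the induction: invariance under the trivial
    subgroup is automatic and there is no variance.\<close>
  have "averaging G T (Hs ! 0) d (\<Sum>j<0. (chain_step d (Hs ! j) (Hs ! Suc j))\<^sup>2) (\<lambda>f. f)"
    by unfold_locales (auto simp: H0)
  then show ?case by blast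
next
  case (Suc i)
  then obtain A where "averaging G T (Hs ! i) d (\<Sum>j<i. (chain_step d (Hs ! j) (Hs ! Suc j))\<^sup>2) A"
    by auto
  then interpret A: averaging G T "Hs ! i" d "\<Sum>j<i. (chain_step d (Hs ! j) (Hs ! Suc j))\<^sup>2" A .
  have "Hs ! j \<in> amenable_subgroups G T" if "j < length Hs" for j
    using Hs that nth_mem unfolding amenable_chains_def by blast
  then have am: "Hs ! i \<in> amenable_subgroups G T" "Hs ! Suc i \<in> amenable_subgroups G T"
    using Suc.prems by auto
  then have sub: "subgroup (Hs ! i) G" "subgroup (Hs ! Suc i) G"
    by (auto simp: amenable_subgroups_def)
  obtain \<mu> where "invariant_mean (G\<lparr>carrier := Hs ! Suc i\<rparr>) (subtopology T (Hs ! Suc i)) \<mu>"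
    using am(2) topological_group.amenable_iff_invariant_mean[OF topological_group_subgroup[OF sub(2)]]
    unfolding amenable_subgroups_def by blast
  from A.extend[OF sub(2) this d(3) chain_oscillation[OF d sub]]
  show ?case by auto
qed

text \<open>The chain ends with the whole group, so the last averaging operator produces functions
  constant on the carrier; evaluation at the identity is the required mean.\<close>

lemma invariant_mean_of_chain:
  assumes Hs: "Hs \<in> amenable_chains G T"
    and d: "pseudo_metric_on (carrier G) d" "bounded_dist_on (carrier G) d" "right_invariant G d"
  shows "\<exists>\<mu>. invariant_mean G T \<mu> \<and> (\<forall>f\<in>RUCB G T. lipschitz_dist (carrier G) d f \<longrightarrow>
    \<mu> (\<lambda>x. (f x)\<^sup>2) \<le> (\<mu> f)\<^sup>2 + (chain_length G Hs d)\<^sup>2)"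
proof -
  let ?n = "length Hs - 1" and ?s = "(chain_length G Hs d)\<^sup>2"
  have "Hs \<noteq> []" and last: "Hs ! ?n = carrier G"
    using Hs by (auto simp: amenable_chains_def last_conv_nth)
  then have "?n < length Hs" by simp
  moreover have "(\<Sum>j<?n. (chain_step d (Hs ! j) (Hs ! Suc j))\<^sup>2) = ?s"
    unfolding chain_length_def chain_step_def by (simp add: sum_nonneg)
  ultimately obtain A where "averaging G T (carrier G) d ?s A"
    using averaging_along_chain[OF Hs d, of ?n] last by auto
  then interpret A: averaging G T "carrier G" d ?s A .
  \<comment> \<open>Equivariance moves \<open>g\<close> into the argument of \<open>A f\<close>,
    where right invariance under the whole group absorbs it.\<close>
  have invariant: "A (\<lambda>x. f (g \<otimes> x)) \<one> = A f \<one>" if "f \<in> RUCB G T" "g \<in> carrier G" for f g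
    using A.translate[OF that one_closed] A.right_invariant[OF that(1) one_closed that(2)] that(2) by simp
  have "invariant_mean G T (\<lambda>f. A f \<one>)"
    by unfold_locales (auto simp: A.add A.cmult A.nonneg A.one invariant)
  then show ?thesis using A.variance[OF _ _ one_closed] by blast
qed

end

section \<open>Vanishing amenable length and fixed points\<close>

text \<open>The infimal convolution of \<open>\<phi>\<close> with \<open>2 * B * d\<close>, as in
  McShane's extension theorem. The Lipschitz constant depends only on the bound \<open>B\<close>,
  not on \<open>M\<close> or \<open>d\<close>, so it can be fixed before the approximating subgroup
  is chosen.\<close>

lemma lipschitz_approximation:
  assumes d: "pseudo_metric_on M d"
    and B: "\<And>x. x \<in> M \<Longrightarrow> \<bar>\<phi> x\<bar> \<le> B"
    and \<epsilon>: "\<And>x y. x \<in> M \<Longrightarrow> y \<in> M \<Longrightarrow> d x y < 1 \<Longrightarrow> \<phi> x - \<phi> y \<le> \<epsilon>"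
  shows "\<exists>\<psi>. (\<forall>x\<in>M. \<forall>y\<in>M. \<psi> x - \<psi> y \<le> 2 * B * d x y) \<and> (\<forall>x\<in>M. \<bar>\<phi> x - \<psi> x\<bar> \<le> \<epsilon>)"
proof -
  define \<psi> where "\<psi> x = (INF y\<in>M. \<phi> y + 2 * B * d x y)" for x
  \<comment> \<open>A point closer than 1 lowers the value by at most \<epsilon>; a point farther
    away costs at least \<open>2 * B\<close>, which outweighs any drop of a function bounded by
    \<open>B\<close>.\<close>
  have lower: "\<phi> x - \<epsilon> \<le> \<phi> y + 2 * B * d x y" if x: "x \<in> M" and y: "y \<in> M" for x y
  proof (cases "d x y < 1")
    case True
    have "0 \<le> B * d x y"
      using B[OF x] d x y by (intro mult_nonneg_nonneg) (auto simp: pseudo_metric_on_def)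
    then show ?thesis using \<epsilon>[OF x y True] by linarith
  next
    case False
    have "0 \<le> \<epsilon>" using \<epsilon>[OF x x] d x by (simp add: pseudo_metric_on_def)
    moreover have "2 * B \<le> 2 * B * d x y"
      using mult_left_mono[of 1 "d x y" "2 * B"] False B[OF x] by simp
    ultimately show ?thesis using B[OF x] B[OF y] by linarith
  qed
  have bdd: "bdd_below ((\<lambda>y. \<phi> y + 2 * B * d x y) ` M)" if "x \<in> M" for x
    using lower[OF that] by (intro bdd_belowI2[of _ "\<phi> x - \<epsilon>"])
  have "\<bar>\<phi> x - \<psi> x\<bar> \<le> \<epsilon>" if x: "x \<in> M" for x
  proof -
    have "\<phi> x - \<epsilon> \<le> \<psi> x"
      unfolding \<psi>_def using x lower by (intro cINF_greatest) auto
    moreover have "\<psi> x \<le> \<phi> x + 2 * B * d x x"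
      unfolding \<psi>_def using x bdd by (intro cINF_lower) auto
    moreover have "0 \<le> \<epsilon>" using \<epsilon>[OF x x] d x by (simp add: pseudo_metric_on_def)
    ultimately show ?thesis using d x by (auto simp: pseudo_metric_on_def)
  qed
  moreover have "\<psi> x - \<psi> y \<le> 2 * B * d x y" if x: "x \<in> M" and y: "y \<in> M" for x y
  proof -
    have "\<psi> x - 2 * B * d x y \<le> \<psi> y"
      unfolding \<psi>_def[of y]
    proof (rule cINF_greatest)
      fix z assume z: "z \<in> M"
      have "\<psi> x \<le> \<phi> z + 2 * B * d x z"
        unfolding \<psi>_def using x z bdd by (intro cINF_lower) auto
      also have "\<dots> \<le> \<phi> z + 2 * B * (d x y + d y z)"
        using B[OF x] d x y z by (intro add_left_mono mult_left_mono) (auto simp: pseudo_metric_on_def)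
      finally show "\<psi> x - 2 * B * d x y \<le> \<phi> z + 2 * B * d y z" by (simp add: algebra_simps)
    qed (use x in auto)
    then show ?thesis by simp
  qed
  ultimately show ?thesis by blast
qed

section \<open>Concentration and almost invariant points\<close>

context topological_group
begin

text \<open>Right invariance gives \<open>d x (g \<otimes> x) = d \<one> g\<close>, so on the
  \<epsilon>-ball around the identity, which is open, translation changes \<open>f\<close> by at
  most \<epsilon> uniformly in \<open>x\<close>.\<close>

lemma RUCB_lipschitz:
  assumes d: "d \<in> Delta G T" and f: "lipschitz_dist (carrier G) d f"
  shows "f \<in> RUCB G T"
proof -
  have pm: "pseudo_metric_on (carrier G) d" and ri: "right_invariant G d"
    and op: "\<And>U. pseudo_metric_open (carrier G) d U \<Longrightarrow> openin T U"
    using d by (auto simp: Delta_def)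
  have sym: "d x y = d y x" if "x \<in> carrier G" "y \<in> carrier G" for x y
    using pm that by (simp add: pseudo_metric_on_def)
  have abs: "\<bar>f x - f y\<bar> \<le> d x y" if "x \<in> carrier G" "y \<in> carrier G" for x y
  proof -
    have "f x - f y \<le> d x y" "f y - f x \<le> d y x" using f that unfolding lipschitz_dist_def by blast+
    then show ?thesis using sym[OF that] by linarith
  qed
  obtain B where B: "\<And>p. p \<in> carrier G \<times> carrier G \<Longrightarrow> \<bar>case p of (x, y) \<Rightarrow> d x y\<bar> \<le> B"
    using d unfolding Delta_def bounded_dist_on_def bounded_iff by auto
  show ?thesis
  proof (rule RUCB_I)
    show "\<bar>f x\<bar> \<le> \<bar>f \<one>\<bar> + B" if "x \<in> carrier G" for x
      using abs[OF that one_closed] B[of "(x, \<one>)"] that by simp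
    fix \<epsilon> :: real assume \<epsilon>: "\<epsilon> > 0"
    let ?U = "{g \<in> carrier G. d \<one> g < \<epsilon>}"
    have "pseudo_metric_open (carrier G) d ?U"
      unfolding pseudo_metric_open_def
    proof (intro conjI ballI)
      fix x assume x: "x \<in> ?U"
      have "d \<one> y \<le> d \<one> x + d x y" if "y \<in> carrier G" for y
        using pm x that unfolding pseudo_metric_on_def by blast
      then have "{y \<in> carrier G. d x y < \<epsilon> - d \<one> x} \<subseteq> ?U" by fastforce
      then show "\<exists>r>0. {y \<in> carrier G. d x y < r} \<subseteq> ?U"
        using x by (intro exI[of _ "\<epsilon> - d \<one> x"]) auto
    qed auto
    then have "openin T ?U" by (rule op)
    moreover have "\<one> \<in> ?U" using pm \<epsilon> by (auto simp: pseudo_metric_on_def)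
    ultimately have "neighbourhood_in T \<one> ?U"
      unfolding neighbourhood_in_def topspace_eq by blast
    moreover have "\<bar>f x - f (g \<otimes> x)\<bar> \<le> \<epsilon>" if g: "g \<in> ?U" and x: "x \<in> carrier G" for g x
    proof -
      have "d (\<one> \<otimes> x) (g \<otimes> x) = d \<one> g" using ri g x unfolding right_invariant_def by blast
      then show ?thesis using abs[of x "g \<otimes> x"] g x by simp
    qed
    ultimately show "\<exists>U. neighbourhood_in T \<one> U \<and> (\<forall>g\<in>U. \<forall>x\<in>carrier G. \<bar>f x - f (g \<otimes> x)\<bar> \<le> \<epsilon>)"
      by blast
  qed
qed

text \<open>Chebyshev's inequality: the mean of the sum of all squared deviations is small, so this sum
  is small at some point.\<close>
lemma concentration:
  assumes d: "d \<in> Delta G T" and \<delta>: "amenable_length G T d < ennreal \<delta>"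
    and I: "finite I" and f: "\<And>i. i \<in> I \<Longrightarrow> lipschitz_dist (carrier G) d (f i)"
    and h: "\<And>i. i \<in> I \<Longrightarrow> h i \<in> carrier G"
    and \<epsilon>: "\<epsilon> > 0" "2 * real (card I) * \<delta>\<^sup>2 < \<epsilon>\<^sup>2"
  shows "\<exists>x\<in>carrier G. \<forall>i\<in>I. \<bar>f i (h i \<otimes> x) - f i x\<bar> \<le> 2 * \<epsilon>"
proof -
  have pm: "pseudo_metric_on (carrier G) d" and bd: "bounded_dist_on (carrier G) d"
    and ri: "right_invariant G d"
    using d by (auto simp: Delta_def)
  obtain Hs where Hs: "Hs \<in> amenable_chains G T" "ennreal (chain_length G Hs d) < ennreal \<delta>"
    using \<delta> unfolding amenable_length_def INF_less_iff by blast
  have nn: "0 \<le> chain_length G Hs d" unfolding chain_length_def by (simp add: sum_nonneg)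
  then have lt: "(chain_length G Hs d)\<^sup>2 \<le> \<delta>\<^sup>2"
    using Hs(2) by (intro power_mono) (auto simp: ennreal_less_iff)
  obtain \<mu> where "invariant_mean G T \<mu>"
    and var: "\<And>f. f \<in> RUCB G T \<Longrightarrow> lipschitz_dist (carrier G) d f \<Longrightarrow>
      \<mu> (\<lambda>x. (f x)\<^sup>2) \<le> (\<mu> f)\<^sup>2 + (chain_length G Hs d)\<^sup>2"
    using invariant_mean_of_chain[OF Hs(1) pm bd ri] by blast
  then interpret M: invariant_mean G T \<mu> by simp
  have fR: "f i \<in> RUCB G T" if "i \<in> I" for i
    using RUCB_lipschitz[OF d f[OF that]] .
  define q where "q i x = (f i x - \<mu> (f i))\<^sup>2" for i x
  have qR: "q i \<in> RUCB G T" if "i \<in> I" for i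
    unfolding q_def by (intro RUCB_power2 RUCB_diff_const fR that)
  have qmu: "\<mu> (q i) \<le> \<delta>\<^sup>2" if "i \<in> I" for i
    using var[OF fR[OF that] f[OF that]] lt
    unfolding q_def M.square_deviation[OF fR[OF that]] by (simp add: power2_eq_square)
  \<comment> \<open>Each index contributes the deviation at \<open>x\<close> and the one at
    \<open>h i \<otimes> x\<close>. By left invariance both have mean at most
    \<open>\<delta>\<^sup>2\<close>, whence the factor 2 in the assumption on \<epsilon>.\<close>
  define S where "S x = (\<Sum>i\<in>I. q i (h i \<otimes> x) + q i x)" for x
  have qR': "(\<lambda>x. q i (h i \<otimes> x)) \<in> RUCB G T" if "i \<in> I" for i
    by (intro RUCB_translate qR h that)
  have "\<mu> S = (\<Sum>i\<in>I. \<mu> (\<lambda>x. q i (h i \<otimes> x) + q i x))"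
    unfolding S_def by (intro M.sum RUCB_add qR qR')
  also have "\<dots> \<le> (\<Sum>i\<in>I. 2 * \<delta>\<^sup>2)"
  proof (rule sum_mono)
    fix i assume i: "i \<in> I"
    have "\<mu> (\<lambda>x. q i (h i \<otimes> x) + q i x) = \<mu> (q i) + \<mu> (q i)"
      using M.add[OF qR'[OF i] qR[OF i]] M.invariant[OF qR[OF i] h[OF i]] by simp
    then show "\<mu> (\<lambda>x. q i (h i \<otimes> x) + q i x) \<le> 2 * \<delta>\<^sup>2" using qmu[OF i] by simp
  qed
  also have "\<dots> < \<epsilon>\<^sup>2" using \<epsilon>(2) by (simp add: mult_ac)
  finally have "\<mu> S < \<epsilon>\<^sup>2" .
  moreover have "S \<in> RUCB G T"
    unfolding S_def by (intro RUCB_sum RUCB_add qR qR')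
  \<comment> \<open>If \<open>S\<close> were at least \<open>\<epsilon>\<^sup>2\<close> everywhere,
    its mean would be too.\<close>
  ultimately obtain x where x: "x \<in> carrier G" "S x < \<epsilon>\<^sup>2"
    using M.ge_const[of S "\<epsilon>\<^sup>2"] by force
  have "\<bar>f i (h i \<otimes> x) - f i x\<bar> \<le> 2 * \<epsilon>" if i: "i \<in> I" for i
  proof -
    have nonneg: "0 \<le> q j y" for j y unfolding q_def by simp
    have "q i (h i \<otimes> x) + q i x \<le> S x"
      unfolding S_def by (rule member_le_sum[OF i _ I]) (simp add: nonneg)
    then have "q i (h i \<otimes> x) \<le> \<epsilon>\<^sup>2" "q i x \<le> \<epsilon>\<^sup>2"
      using x(2) nonneg[of i x] nonneg[of i "h i \<otimes> x"] by linarith+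
    then have "\<bar>f i (h i \<otimes> x) - \<mu> (f i)\<bar> \<le> \<epsilon>" "\<bar>f i x - \<mu> (f i)\<bar> \<le> \<epsilon>"
      unfolding q_def using \<epsilon>(1) by (simp_all add: abs_le_square_iff[symmetric])
    then show ?thesis by linarith
  qed
  then show ?thesis using x(1) by blast
qed

lemma approximant_of_group_length_eq_0:
  assumes "group_length G T = 0" "neighbourhood_in T \<one> U" "F \<subseteq> carrier G" "finite F" "\<delta> > 0"
  obtains H d where "(H, d) \<in> approximants G T U F" "subgroup_length G T H d < ennreal \<delta>"
proof -
  have "(INF (H, d)\<in>approximants G T U F. subgroup_length G T H d) \<le> group_length G T"
    unfolding group_length_def using assms(2-4) by (intro SUP_upper2[of "(U, F)"]) auto
  then have "(INF (H, d)\<in>approximants G T U F. subgroup_length G T H d) < ennreal \<delta>"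
    using assms(1,5) by simp
  then show ?thesis unfolding INF_less_iff using that by auto
qed

text \<open>Each \<open>g i\<close> factors as \<open>u i \<otimes> h i\<close> with
  \<open>u i\<close> in a neighbourhood that hardly moves any of the functions and
  \<open>h i\<close> in a subgroup \<open>H\<close> of small length. On \<open>H\<close> the
  functions are uniformly close to Lipschitz ones, and concentration provides a point at which
  translation by every \<open>h i\<close> has little effect.\<close>

lemma almost_invariant_point:
  assumes zero: "group_length G T = 0" and I: "finite I"
    and \<phi>: "\<And>i. i \<in> I \<Longrightarrow> \<phi> i \<in> RUCB G T" and g: "\<And>i. i \<in> I \<Longrightarrow> g i \<in> carrier G"
    and \<epsilon>: "\<epsilon> > 0"
  shows "\<exists>x\<in>carrier G. \<forall>i\<in>I. \<bar>\<phi> i (g i \<otimes> x) - \<phi> i x\<bar> \<le> \<epsilon>"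
proof -
  \<comment> \<open>Of the five parts, one pays for \<open>u i\<close>, two for the Lipschitz
    approximation at two points, and two for concentration.\<close>
  define \<eta> where "\<eta> = \<epsilon> / 5"
  have \<eta>: "\<eta> > 0" using \<epsilon> by (simp add: \<eta>_def)
  have "\<exists>U. neighbourhood_in T \<one> U \<and> (\<forall>u\<in>U. \<forall>x\<in>carrier G. \<bar>\<phi> i x - \<phi> i (u \<otimes> x)\<bar> \<le> \<eta>)"
    if "i \<in> I" for i
    using \<phi>[OF that] \<eta> by (auto simp: RUCB_def)
  then obtain U where U: "\<And>i. i \<in> I \<Longrightarrow> neighbourhood_in T \<one> (U i)"
    "\<And>i u x. i \<in> I \<Longrightarrow> u \<in> U i \<Longrightarrow> x \<in> carrier G \<Longrightarrow> \<bar>\<phi> i x - \<phi> i (u \<otimes> x)\<bar> \<le> \<eta>"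
    by metis
  define V where "V = topspace T \<inter> (\<Inter>i\<in>I. U i)"
  have V: "neighbourhood_in T \<one> V"
    unfolding V_def by (intro neighbourhood_in_finite_INT I U one_in_topspace)
  have VU: "\<bar>\<phi> i x - \<phi> i (u \<otimes> x)\<bar> \<le> \<eta>" if "i \<in> I" "u \<in> V" "x \<in> carrier G" for i u x
    using U(2)[of i u x] that by (auto simp: V_def)
  have "\<exists>B>0. \<forall>x\<in>carrier G. \<bar>\<phi> i x\<bar> \<le> B" if "i \<in> I" for i
    using RUCB_boundedE[OF \<phi>[OF that]] by metis
  then obtain b where b: "\<And>i. i \<in> I \<Longrightarrow> b i > 0" "\<And>i x. i \<in> I \<Longrightarrow> x \<in> carrier G \<Longrightarrow> \<bar>\<phi> i x\<bar> \<le> b i"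
    by metis
  \<comment> \<open>The summand 1 keeps \<open>B\<close> positive for empty
    \<open>I\<close>.\<close>
  define B where "B = (\<Sum>i\<in>I. b i) + 1"
  have Bpos: "B > 0" unfolding B_def using b(1) by (intro add_nonneg_pos sum_nonneg) (auto intro: less_imp_le)
  have B: "\<bar>\<phi> i x\<bar> \<le> B" if "i \<in> I" "x \<in> carrier G" for i x
  proof -
    have "b i \<le> (\<Sum>i\<in>I. b i)" using that b(1) I by (intro member_le_sum) (auto intro: less_imp_le)
    then show ?thesis using b(2)[OF that] unfolding B_def by linarith
  qed
  \<comment> \<open>Division by \<open>2 * B\<close> will make the approximations 1-Lipschitz;
    scaling back turns the error \<open>2 * \<epsilon>'\<close> into
    \<open>2 * \<eta>\<close>.\<close>
  define \<epsilon>' where "\<epsilon>' = \<eta> / (2 * B)"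
  \<comment> \<open>With n the size of \<open>I\<close>, \<epsilon>' is (2n + 1) times \<delta>, and
    2n < (2n + 1)^2 gives the inequality required for concentration.\<close>
  define \<delta> where "\<delta> = \<epsilon>' / (2 * real (card I) + 1)"
  have \<epsilon>': "\<epsilon>' > 0" unfolding \<epsilon>'_def using \<eta> Bpos by simp
  then have \<delta>: "\<delta> > 0" unfolding \<delta>_def by simp
  have \<delta>\<epsilon>: "2 * real (card I) * \<delta>\<^sup>2 < \<epsilon>'\<^sup>2"
  proof -
    have "\<epsilon>' = (2 * real (card I) + 1) * \<delta>" unfolding \<delta>_def by simp
    then have "\<epsilon>'\<^sup>2 = (2 * real (card I) + 1)\<^sup>2 * \<delta>\<^sup>2" by (simp add: power_mult_distrib)
    moreover have "2 * real (card I) < (2 * real (card I) + 1)\<^sup>2"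
      unfolding power2_eq_square distrib_left distrib_right by (simp add: add_nonneg_pos)
    ultimately show ?thesis using \<delta> by simp
  qed
  obtain H d where Hd: "(H, d) \<in> approximants G T V (g ` I)"
    and short: "subgroup_length G T H d < ennreal \<delta>"
    using approximant_of_group_length_eq_0[OF zero V _ _ \<delta>, of "g ` I"] g I by blast
  then have H: "subgroup H G" and d: "d \<in> Delta (G\<lparr>carrier := H\<rparr>) (subtopology T H)"
    and gH: "g ` I \<subseteq> V <#> H" and dV: "{x \<in> H. d \<one> x < 1} \<subseteq> V"
    by (auto simp: approximants_def amenable_subgroups_def)
  interpret H: subgroup H G by fact
  interpret GH: topological_group "G\<lparr>carrier := H\<rparr>" "subtopology T H"
    by (rule topological_group_subgroup) fact
  have pm: "pseudo_metric_on H d" and ri: "right_invariant (G\<lparr>carrier := H\<rparr>) d"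
    using d by (auto simp: Delta_def)
  have "\<forall>i\<in>I. \<exists>u h. u \<in> V \<and> h \<in> H \<and> g i = u \<otimes> h"
    using gH by (fastforce simp: set_mult_def)
  then obtain u h where uh: "\<And>i. i \<in> I \<Longrightarrow> u i \<in> V" "\<And>i. i \<in> I \<Longrightarrow> h i \<in> H" "\<And>i. i \<in> I \<Longrightarrow> g i = u i \<otimes> h i"
    by metis
  have "\<exists>\<psi>. (\<forall>x\<in>H. \<forall>y\<in>H. \<psi> x - \<psi> y \<le> 2 * B * d x y) \<and> (\<forall>x\<in>H. \<bar>\<phi> i x - \<psi> x\<bar> \<le> \<eta>)"
    if i: "i \<in> I" for i
  proof (rule lipschitz_approximation[OF pm])
    show "\<bar>\<phi> i x\<bar> \<le> B" if "x \<in> H" for x using B[OF i] H.mem_carrier[OF that] .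
    fix x y assume x: "x \<in> H" and y: "y \<in> H" and xy: "d x y < 1"
    have xc: "x \<in> carrier G" "y \<in> carrier G" using x y H.mem_carrier by auto
    \<comment> \<open>By right invariance, points of \<open>H\<close> at distance less than 1 differ
      by a left factor in the unit ball, hence in \<open>V\<close>.\<close>
    have "d (\<one> \<otimes> x) ((y \<otimes> inv x) \<otimes> x) = d \<one> (y \<otimes> inv x)"
      using ri[unfolded right_invariant_def, rule_format, of \<one> "y \<otimes> inv x" x] x y by simp
    then have "d \<one> (y \<otimes> inv x) < 1" using xy xc by (simp add: m_assoc)
    then have "y \<otimes> inv x \<in> V" using dV x y by auto
    then have "\<bar>\<phi> i x - \<phi> i (y \<otimes> inv x \<otimes> x)\<bar> \<le> \<eta>" using VU[OF i _ xc(1)] by blast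
    then show "\<phi> i x - \<phi> i y \<le> \<eta>" using xc by (simp add: m_assoc)
  qed
  then obtain \<psi> where \<psi>: "\<And>i x y. i \<in> I \<Longrightarrow> x \<in> H \<Longrightarrow> y \<in> H \<Longrightarrow> \<psi> i x - \<psi> i y \<le> 2 * B * d x y"
    "\<And>i x. i \<in> I \<Longrightarrow> x \<in> H \<Longrightarrow> \<bar>\<phi> i x - \<psi> i x\<bar> \<le> \<eta>"
    by metis
  have lip: "lipschitz_dist (carrier (G\<lparr>carrier := H\<rparr>)) d (\<lambda>x. \<psi> i x / (2 * B))" if "i \<in> I" for i
    using \<psi>(1)[OF that] Bpos by (auto simp: lipschitz_dist_def diff_divide_distrib[symmetric] pos_divide_le_eq mult_ac)
  obtain x where x: "x \<in> H" and "\<And>i. i \<in> I \<Longrightarrow> \<bar>\<psi> i (h i \<otimes> x) / (2 * B) - \<psi> i x / (2 * B)\<bar> \<le> 2 * \<epsilon>'"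
    using GH.concentration[where f = "\<lambda>i x. \<psi> i x / (2 * B)" and h = h, OF d short I lip _ \<epsilon>' \<delta>\<epsilon>] uh(2) by auto
  then have \<psi>x: "\<bar>\<psi> i (h i \<otimes> x) - \<psi> i x\<bar> \<le> 2 * \<eta>" if "i \<in> I" for i
    using that Bpos unfolding \<epsilon>'_def
    by (force simp: diff_divide_distrib[symmetric] abs_divide field_simps)
  have xc: "x \<in> carrier G" using x H.mem_carrier by auto
  have "\<bar>\<phi> i (g i \<otimes> x) - \<phi> i x\<bar> \<le> \<epsilon>" if i: "i \<in> I" for i
  proof -
    have hx: "h i \<otimes> x \<in> H" using uh(2)[OF i] x by simp
    have c: "u i \<in> carrier G" "h i \<in> carrier G" 
      using neighbourhood_in_carrierD[OF V uh(1)[OF i]] uh(2)[OF i] H.mem_carrier by auto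
    have "u i \<otimes> (h i \<otimes> x) = g i \<otimes> x" using uh(3)[OF i] c xc by (simp add: m_assoc)
    moreover have "\<bar>\<phi> i (h i \<otimes> x) - \<phi> i (u i \<otimes> (h i \<otimes> x))\<bar> \<le> \<eta>"
      using VU[OF i uh(1)[OF i]] c xc by simp
    ultimately have "\<bar>\<phi> i (h i \<otimes> x) - \<phi> i (g i \<otimes> x)\<bar> \<le> \<eta>" by simp
    then show ?thesis
      using \<psi>(2)[OF i hx] \<psi>(2)[OF i x] \<psi>x[OF i] unfolding \<eta>_def by linarith
  qed
  then show ?thesis using xc by blast
qed

text \<open>The jointly continuous function \<open>f y - f (\<phi> g y)\<close> vanishes for
  \<open>g = \<one>\<close>. Compactness of \<open>X\<close> and the tube lemma make it small for
  \<open>g\<close> near the identity uniformly in \<open>y\<close>, in particular at all points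
  \<open>\<phi> k x\<close> of the orbit.\<close>

lemma RUCB_orbit_function:
  fixes X :: "'x topology"
  assumes X: "compact_space X" and act: "group_action G (topspace X) \<phi>"
    and cont: "continuous_map (prod_topology T X) X (\<lambda>(g, x). \<phi> g x)"
    and f: "continuous_map X euclideanreal f" and x: "x \<in> topspace X"
  shows "(\<lambda>g. f (\<phi> g x)) \<in> RUCB G T"
proof -
  interpret A: group_action G "topspace X" \<phi> by fact
  have "compactin euclideanreal (f ` topspace X)"
    using X f image_compactin unfolding compact_space_def by blast
  then have "bounded (f ` topspace X)" by (auto intro: compact_imp_bounded)
  then obtain B where B: "\<And>y. y \<in> topspace X \<Longrightarrow> \<bar>f y\<bar> \<le> B" by (auto simp: bounded_iff)
  show ?thesis
  proof (rule RUCB_I)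
    show "\<bar>f (\<phi> g x)\<bar> \<le> B" if "g \<in> carrier G" for g
      using B A.element_image[OF that x] by blast
    fix \<epsilon> :: real assume \<epsilon>: "\<epsilon> > 0"
    define F where "F = (\<lambda>p. f (snd p) - f (case p of (g, y) \<Rightarrow> \<phi> g y))"
    have "continuous_map (prod_topology T X) euclideanreal F"
      unfolding F_def using continuous_map_compose[OF continuous_map_snd f] continuous_map_compose[OF cont f]
      by (intro continuous_map_diff) (auto simp: o_def)
    moreover have "openin euclideanreal {-\<epsilon><..<\<epsilon>}" by simp
    ultimately have W: "openin (prod_topology T X) {p \<in> topspace (prod_topology T X). F p \<in> {-\<epsilon><..<\<epsilon>}}"
      by (rule openin_continuous_map_preimage)
    have id: "\<phi> \<one> y = y" if "y \<in> topspace X" for y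
      using A.id_eq_one that by (metis restrict_apply')
    have "\<exists>U V. openin T U \<and> openin X V \<and> \<one> \<in> U \<and> topspace X \<subseteq> V \<and>
        U \<times> V \<subseteq> {p \<in> topspace (prod_topology T X). F p \<in> {-\<epsilon><..<\<epsilon>}}"
      by (rule tube_lemma_right[OF W]) (use X \<epsilon> id in \<open>auto simp: compact_space_def F_def\<close>)
    then obtain U V where U: "openin T U" "\<one> \<in> U" "topspace X \<subseteq> V"
      "U \<times> V \<subseteq> {p \<in> topspace (prod_topology T X). F p \<in> {-\<epsilon><..<\<epsilon>}}" by blast
    have "\<bar>f (\<phi> k x) - f (\<phi> (g \<otimes> k) x)\<bar> \<le> \<epsilon>" if g: "g \<in> U" and k: "k \<in> carrier G" for g k
    proof -
      have gc: "g \<in> carrier G" using g U(1) openin_subset topspace_eq by blast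
      have "\<phi> k x \<in> topspace X" using A.element_image[OF k x] by blast
      then have "F (g, \<phi> k x) \<in> {-\<epsilon><..<\<epsilon>}" using U g by blast
      then show ?thesis using A.composition_rule[OF x gc k] by (auto simp: F_def)
    qed
    moreover have "neighbourhood_in T \<one> U"
      using U openin_subset unfolding neighbourhood_in_def by blast
    ultimately show "\<exists>U. neighbourhood_in T \<one> U \<and>
        (\<forall>g\<in>U. \<forall>k\<in>carrier G. \<bar>f (\<phi> k x) - f (\<phi> (g \<otimes> k) x)\<bar> \<le> \<epsilon>)" by blast
  qed
qed

text \<open>A fixed point is a point that no continuous function can distinguish from its
  translates. Near invariance under one function and one group element is a closed condition;
  finitely many such conditions hold together somewhere on any given orbit, and compactness yields a
  point satisfying all of them.\<close>

theorem extremely_amenable_of_group_length_eq_0: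
  assumes zero: "group_length G T = 0"
  shows "extremely_amenable TYPE('x) G T"
  unfolding extremely_amenable_def
proof (intro allI impI, elim conjE)
  fix X :: "'x topology" and \<phi>
  assume X: "compact_space X" and haus: "Hausdorff_space X" and ne: "topspace X \<noteq> {}"
    and act: "group_action G (topspace X) \<phi>"
    and cont: "continuous_map (prod_topology T X) X (\<lambda>(g, x). \<phi> g x)"
  interpret A: group_action G "topspace X" \<phi> by fact
  obtain z where z: "z \<in> topspace X" using ne by blast
  \<comment> \<open>The tolerance 1 suffices for all functions, because a function separating two
    points can be chosen with values 0 and 2 there.\<close>
  define C where "C = (\<lambda>(f, g). {x \<in> topspace X. \<bar>f (\<phi> g x) - f x\<bar> \<le> (1::real)})"
  define J where "J = {(f, g). continuous_map X euclideanreal f \<and> g \<in> carrier G}"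
  have contg: "continuous_map X X (\<phi> g)" if "g \<in> carrier G" for g
  proof -
    have "continuous_map X (prod_topology T X) (\<lambda>x. (g, x))"
      by (intro continuous_map_pairedI) (use that in \<open>auto simp: topspace_eq\<close>)
    from continuous_map_compose[OF this cont] show ?thesis by (simp add: o_def)
  qed
  have closed: "closedin X (C p)" if "p \<in> J" for p
  proof -
    obtain f g where p: "p = (f, g)" "continuous_map X euclideanreal f" "g \<in> carrier G"
      using \<open>p \<in> J\<close> unfolding J_def by blast
    have "continuous_map X euclideanreal (\<lambda>x. f (\<phi> g x) - f x)"
      using continuous_map_compose[OF contg[OF p(3)] p(2)] p(2)
      by (intro continuous_map_diff) (auto simp: o_def)
    from closedin_continuous_map_preimage[OF this, of "{-1..1}"]
    have "closedin X {x \<in> topspace X. f (\<phi> g x) - f x \<in> {-1..1}}" by simp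
    moreover have "{x \<in> topspace X. f (\<phi> g x) - f x \<in> {-1..1}} = C p"
      unfolding C_def p by (auto simp: abs_le_iff)
    ultimately show ?thesis by simp
  qed
  \<comment> \<open>Along the orbit of \<open>z\<close>, the finitely many conditions become near
    invariance of orbit functions, which lie in RUCB.\<close>
  have fip: "\<Inter>\<F> \<noteq> {}" if \<F>: "finite \<F>" "\<F> \<subseteq> C ` J" for \<F>
  proof -
    obtain I where I: "I \<subseteq> J" "finite I" "\<F> = C ` I"
      using finite_subset_image[OF \<F>] by blast
    have "\<exists>k\<in>carrier G. \<forall>p\<in>I. \<bar>fst p (\<phi> (snd p \<otimes> k) z) - fst p (\<phi> k z)\<bar> \<le> 1"
    proof (rule almost_invariant_point[OF zero I(2), of "\<lambda>p k. fst p (\<phi> k z)" snd 1])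
      show "(\<lambda>k. fst p (\<phi> k z)) \<in> RUCB G T" if "p \<in> I" for p
        by (rule RUCB_orbit_function[OF X act cont _ z]) (use I(1) that in \<open>auto simp: J_def\<close>)
      show "snd p \<in> carrier G" if "p \<in> I" for p
        using I(1) that by (auto simp: J_def)
    qed simp
    then obtain k where k: "k \<in> carrier G"
      "\<And>p. p \<in> I \<Longrightarrow> \<bar>fst p (\<phi> (snd p \<otimes> k) z) - fst p (\<phi> k z)\<bar> \<le> 1" by blast
    have "\<phi> k z \<in> C p" if p: "p \<in> I" for p
    proof -
      have "snd p \<in> carrier G" using I(1) p by (auto simp: J_def)
      then show ?thesis
        using k(2)[OF p] A.composition_rule[OF z _ k(1), of "snd p"] A.element_image[OF k(1) z]
        by (auto simp: C_def split_beta)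
    qed
    then show ?thesis unfolding I(3) by blast
  qed
  have "\<Inter>(C ` J) \<noteq> {}"
    using X closed fip unfolding compact_space_fip by blast
  then obtain x where x: "\<And>p. p \<in> J \<Longrightarrow> x \<in> C p" by blast
  \<comment> \<open>Membership in at least one of the sets is what places \<open>x\<close> in the
    space.\<close>
  have "((\<lambda>_. 0), \<one>) \<in> J" unfolding J_def by simp
  from x[OF this] have xX: "x \<in> topspace X" unfolding C_def by simp
  have "\<phi> g x = x" if g: "g \<in> carrier G" for g
  proof (rule ccontr)
    assume neq: "\<phi> g x \<noteq> x"
    have gx: "\<phi> g x \<in> topspace X" using A.element_image[OF g xX] by blast
    have "normal_space X" using X haus compact_Hausdorff_or_regular_imp_normal_space by blast
    moreover have "closedin X {\<phi> g x}" "closedin X {x}"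
      using haus gx xX by (auto intro: closedin_Hausdorff_singleton)
    ultimately obtain f where f: "continuous_map X euclideanreal f" "f ` {\<phi> g x} \<subseteq> {0}" "f ` {x} \<subseteq> {2::real}"
      using neq by (rule_tac Urysohn_lemma_alt[of X "{\<phi> g x}" "{x}" 0 2]) (auto simp: disjnt_def)
    then have "(f, g) \<in> J" using g by (simp add: J_def)
    from x[OF this] f(2,3) show False unfolding C_def by simp
  qed
  then show "\<exists>x\<in>topspace X. \<forall>g\<in>carrier G. \<phi> g x = x" using xX by blast
qed

end

section \<open>Groups approximated by subgroups of small amenable length\<close>

lemma pseudo_metric_on_scale:
  assumes "pseudo_metric_on M d" "c \<ge> 0"
  shows "pseudo_metric_on M (\<lambda>x y. c * d x y)"
  using assms unfolding pseudo_metric_on_def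
  by (auto simp: distrib_left[symmetric] intro!: mult_left_mono)

lemma bounded_dist_on_scale:
  assumes "bounded_dist_on M d"
  shows "bounded_dist_on M (\<lambda>x y. c * d x y)"
proof -
  have "(\<lambda>(x, y). c * d x y) ` (M \<times> M) = (\<lambda>r. c *\<^sub>R r) ` (\<lambda>(x, y). d x y) ` (M \<times> M)"
    unfolding image_image by (intro image_cong) auto
  then show ?thesis using assms bounded_scaling unfolding bounded_dist_on_def by metis
qed

lemma right_invariant_scale: "right_invariant G d \<Longrightarrow> right_invariant G (\<lambda>x y. c * d x y)"
  unfolding right_invariant_def by simp

lemma closure_of_meets_open:
  assumes "openin T W" "x \<in> W" "x \<in> T closure_of S"
  obtains y where "y \<in> S" "y \<in> W"
  using assms unfolding in_closure_of by blast

lemma subset_mono_set_mult: "H \<subseteq> H' \<Longrightarrow> U <#>\<^bsub>G\<^esub> H \<subseteq> U <#>\<^bsub>G\<^esub> H'"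
  unfolding set_mult_def by blast

lemma directed_by_inclusion_finite_upper_bound:
  assumes "directed_by_inclusion \<H>" "finite I" "\<And>i. i \<in> I \<Longrightarrow> A i \<in> \<H>"
  shows "\<exists>B\<in>\<H>. \<forall>i\<in>I. A i \<subseteq> B"
  using assms(2,3)
proof (induction I rule: finite_induct)
  case empty
  then show ?case using assms(1) by (auto simp: directed_by_inclusion_def)
next
  case (insert i I)
  then obtain B where "B \<in> \<H>" "\<forall>i\<in>I. A i \<subseteq> B" "A i \<in> \<H>" by auto
  moreover obtain C where "C \<in> \<H>" "A i \<subseteq> C" "B \<subseteq> C"
    using assms(1) calculation unfolding directed_by_inclusion_def by blast
  ultimately show ?case by blast
qed

section \<open>Chain lengths under scaling and the vanishing of the group length\<close>

context topological_group
begin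

lemma chain_step_least:
  assumes d: "right_invariant G d" and K: "subgroup K G" and L: "subgroup L G"
    and D: "\<And>x a b. x \<in> carrier G \<Longrightarrow> a \<in> L \<Longrightarrow> b \<in> L \<Longrightarrow> (INF h\<in>K. d (x \<otimes> a) (x \<otimes> b \<otimes> h)) \<le> D"
  shows "chain_step d K L \<le> D"
  unfolding chain_step_def
proof (rule cSUP_least)
  interpret L: subgroup L G by fact
  let ?C = "lcosets\<^bsub>G\<lparr>carrier := L\<rparr>\<^esub> K"
  note C = lcosets_carrier_update
  fix g assume g: "g \<in> carrier G"
  show "diam ?C (coset_dist G K d g) \<le> D"
    unfolding diam_def
  proof (rule cSUP_least)
    show "?C \<times> ?C \<noteq> {}" unfolding C using L.one_closed by blast
    show "(case p of (A, B) \<Rightarrow> coset_dist G K d g A B) \<le> D" if "p \<in> ?C \<times> ?C" for p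
      using that g L.mem_carrier unfolding C
      by (auto simp: coset_dist_l_coset[OF is_group K d] intro: D)
  qed
qed auto

text \<open>The coset of the identity has non-negative distance from itself. With this, inequalities
  between steps can be squared and summed.\<close>

lemma chain_step_nonneg:
  assumes d: "pseudo_metric_on (carrier G) d" "bounded_dist_on (carrier G) d" "right_invariant G d"
    and K: "subgroup K G" and L: "subgroup L G"
  shows "0 \<le> chain_step d K L"
proof -
  interpret K: subgroup K G by fact
  interpret L: subgroup L G by fact
  have "0 \<le> (INF h\<in>K. d (\<one> \<otimes> \<one>) (\<one> \<otimes> \<one> \<otimes> h))"
  proof (rule cINF_greatest)
    show "K \<noteq> {}" using K.one_closed by blast
    show "0 \<le> d (\<one> \<otimes> \<one>) (\<one> \<otimes> \<one> \<otimes> h)" if "h \<in> K" for h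
      using d(1) K.mem_carrier[OF that] by (simp add: pseudo_metric_on_def)
  qed
  also have "\<dots> \<le> chain_step d K L"
    by (intro dist_le_chain_step d K L) auto
  finally show ?thesis .
qed

text \<open>The factor \<open>c\<close> is moved out of the infimum by dividing by it, and then out
  of the suprema because they are least upper bounds.\<close>

lemma chain_step_scale_le:
  assumes d: "pseudo_metric_on (carrier G) d" "bounded_dist_on (carrier G) d" "right_invariant G d"
    and K: "subgroup K G" and L: "subgroup L G" and c: "c > 0"
  shows "chain_step (\<lambda>x y. c * d x y) K L \<le> c * chain_step d K L"
proof (rule chain_step_least[OF right_invariant_scale[OF d(3)] K L])
  interpret K: subgroup K G by fact
  interpret L: subgroup L G by fact
  fix x a b assume x: "x \<in> carrier G" and a: "a \<in> L" and b: "b \<in> L"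
  have "(INF h\<in>K. c * d (x \<otimes> a) (x \<otimes> b \<otimes> h)) / c \<le> (INF h\<in>K. d (x \<otimes> a) (x \<otimes> b \<otimes> h))"
  proof (rule cINF_greatest)
    show "K \<noteq> {}" using K.one_closed by blast
    fix h assume h: "h \<in> K"
    have "bdd_below ((\<lambda>h. c * d (x \<otimes> a) (x \<otimes> b \<otimes> h)) ` K)"
      using x a b d(1) c K.mem_carrier L.mem_carrier
      by (intro bdd_belowI2[of _ 0]) (auto simp: pseudo_metric_on_def)
    from cINF_lower[OF this h] show "(INF h\<in>K. c * d (x \<otimes> a) (x \<otimes> b \<otimes> h)) / c \<le> d (x \<otimes> a) (x \<otimes> b \<otimes> h)"
      using c by (simp add: pos_divide_le_eq mult.commute)
  qed
  also have "\<dots> \<le> chain_step d K L" by (intro dist_le_chain_step d K L x a b)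
  finally show "(INF h\<in>K. c * d (x \<otimes> a) (x \<otimes> b \<otimes> h)) \<le> c * chain_step d K L"
    using c by (simp add: pos_divide_le_eq mult.commute)
qed

lemma chain_length_scale_le:
  assumes d: "pseudo_metric_on (carrier G) d" "bounded_dist_on (carrier G) d" "right_invariant G d"
    and Hs: "Hs \<in> amenable_chains G T" and c: "c > 0"
  shows "chain_length G Hs (\<lambda>x y. c * d x y) \<le> c * chain_length G Hs d"
proof -
  have sub: "subgroup (Hs ! j) G" if "j < length Hs" for j
    using Hs nth_mem[OF that] by (auto simp: amenable_chains_def amenable_subgroups_def)
  let ?c = "\<lambda>x y. c * d x y"
  have cd: "pseudo_metric_on (carrier G) ?c" "bounded_dist_on (carrier G) ?c" "right_invariant G ?c"
    using c by (auto intro: pseudo_metric_on_scale bounded_dist_on_scale right_invariant_scale d)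
  have "(\<Sum>i<length Hs - 1. (chain_step ?c (Hs ! i) (Hs ! Suc i))\<^sup>2)
      \<le> (\<Sum>i<length Hs - 1. (c * chain_step d (Hs ! i) (Hs ! Suc i))\<^sup>2)"
    by (intro sum_mono power_mono chain_step_scale_le chain_step_nonneg d cd sub c) auto
  also have "\<dots> = c\<^sup>2 * (\<Sum>i<length Hs - 1. (chain_step d (Hs ! i) (Hs ! Suc i))\<^sup>2)"
    by (simp add: power_mult_distrib sum_distrib_left)
  finally have "sqrt (\<Sum>i<length Hs - 1. (chain_step ?c (Hs ! i) (Hs ! Suc i))\<^sup>2)
      \<le> sqrt (c\<^sup>2 * (\<Sum>i<length Hs - 1. (chain_step d (Hs ! i) (Hs ! Suc i))\<^sup>2))"
    by (rule real_sqrt_le_mono)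
  then show ?thesis
    unfolding chain_length_def chain_step_def[symmetric] using c by (simp add: real_sqrt_mult)
qed

lemma amenable_length_scale_less:
  assumes d: "pseudo_metric_on (carrier G) d" "bounded_dist_on (carrier G) d" "right_invariant G d"
    and c: "c > 0" and less: "amenable_length G T d < ennreal (\<delta> / c)"
  shows "amenable_length G T (\<lambda>x y. c * d x y) < ennreal \<delta>"
proof -
  obtain Hs where Hs: "Hs \<in> amenable_chains G T" "ennreal (chain_length G Hs d) < ennreal (\<delta> / c)"
    using less unfolding amenable_length_def INF_less_iff by blast
  have nn: "0 \<le> chain_length G Hs d'" for d' unfolding chain_length_def by (simp add: sum_nonneg)
  have "chain_length G Hs d < \<delta> / c" using Hs(2) nn by (simp add: ennreal_less_iff)
  then have "c * chain_length G Hs d < \<delta>" using c by (simp add: pos_less_divide_eq mult.commute)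
  then have "chain_length G Hs (\<lambda>x y. c * d x y) < \<delta>"
    using chain_length_scale_le[OF d Hs(1) c] by linarith
  then have "ennreal (chain_length G Hs (\<lambda>x y. c * d x y)) < ennreal \<delta>"
    using nn by (simp add: ennreal_less_iff)
  then show ?thesis unfolding amenable_length_def INF_less_iff using Hs(1) by blast
qed

text \<open>The points \<open>x\<close> with \<open>f \<otimes> inv x\<close> in an open
  neighbourhood of the identity form an open set around \<open>f\<close>, which meets some member of
  the family by density. Directedness then provides one member for all of the finite set.\<close>

lemma dense_Union_finite_subset_set_mult:
  assumes dir: "directed_by_inclusion \<H>" and dense: "T closure_of (\<Union>\<H>) = carrier G"
    and U: "neighbourhood_in T \<one> U" and F: "F \<subseteq> carrier G" "finite F"
    and sub: "\<And>H. H \<in> \<H> \<Longrightarrow> H \<subseteq> carrier G"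
  shows "\<exists>H\<in>\<H>. F \<subseteq> U <#> H"
proof -
  have "\<exists>H\<in>\<H>. f \<in> U <#> H" if f: "f \<in> F" for f
  proof -
    have fc: "f \<in> carrier G" using f F by blast
    obtain V where V: "openin T V" "\<one> \<in> V" "V \<subseteq> U" using U unfolding neighbourhood_in_def by blast
    have "continuous_map T T (\<lambda>x. f \<otimes> inv x)"
      by (intro continuous_map_mult continuous_inv) (use fc in \<open>auto simp: topspace_eq\<close>)
    then have "openin T {x \<in> topspace T. f \<otimes> inv x \<in> V}"
      using V(1) by (rule openin_continuous_map_preimage)
    moreover have "f \<in> {x \<in> topspace T. f \<otimes> inv x \<in> V}" using fc V(2) by (simp add: topspace_eq)
    moreover have "f \<in> T closure_of (\<Union>\<H>)" using fc dense by simp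
    ultimately obtain h where "h \<in> \<Union>\<H>" "h \<in> {x \<in> topspace T. f \<otimes> inv x \<in> V}"
      by (rule_tac closure_of_meets_open)
    then have h: "h \<in> \<Union>\<H>" "h \<in> carrier G" "f \<otimes> inv h \<in> V"
      by (simp_all add: topspace_eq)
    from h(1) obtain H where H: "H \<in> \<H>" "h \<in> H" by (rule UnionE)
    have "f = (f \<otimes> inv h) \<otimes> h" using fc h(2) by (simp add: m_assoc)
    then have "f \<in> U <#> H" using h(3) V(3) H(2) unfolding set_mult_def by blast
    then show ?thesis using H(1) by blast
  qed
  then obtain A where A: "\<And>f. f \<in> F \<Longrightarrow> A f \<in> \<H>" "\<And>f. f \<in> F \<Longrightarrow> f \<in> U <#> A f" by metis
  obtain B where "B \<in> \<H>" "\<forall>f\<in>F. A f \<subseteq> B"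
    using directed_by_inclusion_finite_upper_bound[where A = A, OF dir F(2) A(1)] by blast
  then show ?thesis using A(2) subset_mono_set_mult by blast
qed

lemma scaled_metric_in_Delta:
  assumes metric: "Metric_space (carrier G) d" "Metric_space.mtopology (carrier G) d = T"
    and bd: "bounded_dist_on (carrier G) d" and ri: "right_invariant G d"
    and H: "subgroup H G" and c: "c > 0"
  shows "(\<lambda>x y. c * d x y) \<in> Delta (G\<lparr>carrier := H\<rparr>) (subtopology T H)"
proof -
  interpret M: Metric_space "carrier G" d by fact
  interpret H: subgroup H G by fact
  note HG = H.subset
  let ?c = "\<lambda>x y. c * d x y"
  have "pseudo_metric_on H d"
    using HG by (auto simp: pseudo_metric_on_def M.commute intro: M.triangle)
  then have "pseudo_metric_on H ?c" using c by (intro pseudo_metric_on_scale) auto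
  moreover have "bounded_dist_on H d"
    using bd unfolding bounded_dist_on_def by (rule bounded_subset) (use HG in auto)
  then have "bounded_dist_on H ?c" by (rule bounded_dist_on_scale)
  moreover have "right_invariant (G\<lparr>carrier := H\<rparr>) ?c"
    using ri HG by (auto simp: right_invariant_def)
  moreover have "openin (subtopology T H) W" if W: "pseudo_metric_open H ?c W" for W
  proof -
    \<comment> \<open>The union of all balls of the ambient group whose trace on \<open>H\<close>
      lies in \<open>W\<close>; it remains to see that they cover \<open>W\<close>. A ball of radius
      \<open>r\<close> for the scaled metric has radius \<open>r / c\<close> for
      \<open>d\<close>.\<close>
    define V where "V = \<Union>{M.mball x r | x r. M.mball x r \<inter> H \<subseteq> W}"
    have "openin T V" unfolding V_def metric(2)[symmetric] by (intro openin_Union) auto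
    moreover have "W = V \<inter> H"
    proof (intro equalityI subsetI)
      fix x assume x: "x \<in> W"
      then have xH: "x \<in> H" and xc: "x \<in> carrier G" using W HG by (auto simp: pseudo_metric_open_def)
      obtain r where r: "r > 0" "{y \<in> H. c * d x y < r} \<subseteq> W"
        using W x unfolding pseudo_metric_open_def by blast
      have "M.mball x (r / c) \<inter> H \<subseteq> W"
        using r(2) c by (auto simp: pos_less_divide_eq mult.commute)
      moreover have "x \<in> M.mball x (r / c)" using r c xc by simp
      ultimately show "x \<in> V \<inter> H" unfolding V_def using xH by blast
    qed (auto simp: V_def)
    ultimately show ?thesis unfolding openin_subtopology by blast
  qed
  ultimately show ?thesis unfolding Delta_def by simp
qed

text \<open>For given \<open>U\<close> and \<open>F\<close>, the metric is enlarged until its unit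
  ball lies in \<open>U\<close>. Density and directedness provide a member \<open>H0\<close> with
  \<open>F \<subseteq> U <#> H0\<close>, and the vanishing limit inferior provides a larger member
  so short that it remains short for the enlarged metric.\<close>

lemma group_length_eq_0:
  assumes metric: "Metric_space (carrier G) d" "Metric_space.mtopology (carrier G) d = T"
    and bd: "bounded_dist_on (carrier G) d" and ri: "right_invariant G d"
    and \<H>: "\<H> \<subseteq> amenable_subgroups G T"
    and dir: "directed_by_inclusion \<H>" and dense: "T closure_of (\<Union>\<H>) = carrier G"
    and liminf: "liminf_directed \<H> (\<lambda>H. subgroup_length G T H d) = 0"
  shows "group_length G T = 0"
proof -
  interpret M: Metric_space "carrier G" d by fact
  have sub: "subgroup H G" if "H \<in> \<H>" for H using \<H> that by (auto simp: amenable_subgroups_def)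
  have "(INF (H, d)\<in>approximants G T U F. subgroup_length G T H d) \<le> 0"
    if U: "neighbourhood_in T \<one> U" and F: "F \<subseteq> carrier G" "finite F" for U F
  proof (rule ennreal_le_epsilon)
    fix \<delta> :: real assume \<delta>: "\<delta> > 0"
    obtain V where "openin T V" "\<one> \<in> V" "V \<subseteq> U" using U unfolding neighbourhood_in_def by blast
    then obtain r where r: "r > 0" "M.mball \<one> r \<subseteq> U"
      unfolding metric(2)[symmetric] M.openin_mtopology by blast
    \<comment> \<open>The unit ball of \<open>c * d\<close> is then the \<open>r\<close>-ball of
      \<open>d\<close>.\<close>
    define c where "c = 1 / r"
    have c: "c > 0" using r by (simp add: c_def)
    obtain H0 where H0: "H0 \<in> \<H>" "F \<subseteq> U <#> H0"
      using dense_Union_finite_subset_set_mult[OF dir dense U F subgroup.subset[OF sub]] by blast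
    \<comment> \<open>The limit inferior is a supremum of such infima, so each of them vanishes, in
      particular the one beyond \<open>H0\<close>.\<close>
    have "(INF H\<in>{H \<in> \<H>. H0 \<subseteq> H}. subgroup_length G T H d) \<le> 0"
      using H0(1) unfolding liminf[symmetric] liminf_directed_def by (rule SUP_upper)
    also have "0 < ennreal (\<delta> / c)" using \<delta> c by simp
    finally obtain H where H: "H \<in> \<H>" "H0 \<subseteq> H" "subgroup_length G T H d < ennreal (\<delta> / c)"
      unfolding INF_less_iff by blast
    note subH = sub[OF H(1)]
    interpret H: subgroup H G by fact
    interpret GH: topological_group "G\<lparr>carrier := H\<rparr>" "subtopology T H"
      by (rule topological_group_subgroup) fact
    \<comment> \<open>The scaling factor 1 yields the properties of the restriction of
      \<open>d\<close> itself.\<close>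
    have "(\<lambda>x y. 1 * d x y) \<in> Delta (G\<lparr>carrier := H\<rparr>) (subtopology T H)"
      by (rule scaled_metric_in_Delta[OF metric bd ri subH]) simp
    then have "subgroup_length G T H (\<lambda>x y. c * d x y) < ennreal \<delta>"
      by (intro GH.amenable_length_scale_less c H(3)) (auto simp: Delta_def)
    moreover have "(H, \<lambda>x y. c * d x y) \<in> approximants G T U F"
      unfolding approximants_def
    proof (intro CollectI case_prodI conjI)
      show "H \<in> amenable_subgroups G T" using H(1) \<H> by blast
      show "(\<lambda>x y. c * d x y) \<in> Delta (G\<lparr>carrier := H\<rparr>) (subtopology T H)"
        by (rule scaled_metric_in_Delta[OF metric bd ri subH c])
      show "F \<subseteq> U <#> H" using H0(2) subset_mono_set_mult[OF H(2)] by blast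
      show "{x \<in> H. c * d \<one> x < 1} \<subseteq> U" using r H.mem_carrier by (auto simp: c_def)
    qed
    ultimately have "(INF (H, d)\<in>approximants G T U F. subgroup_length G T H d) < ennreal \<delta>"
      unfolding INF_less_iff by (intro bexI[of _ "(H, \<lambda>x y. c * d x y)"]) auto
    then show "(INF (H, d)\<in>approximants G T U F. subgroup_length G T H d) \<le> 0 + ennreal \<delta>" by simp
  qed
  then have "group_length G T \<le> 0" unfolding group_length_def by (intro SUP_least) auto
  then show ?thesis by simp
qed

end

theorem corollary4p13:
  fixes G :: "('a, 'm) monoid_scheme" and T :: "'a topology"
    and d :: "'a \<Rightarrow> 'a \<Rightarrow> real" and \<H> :: "'a set set"
  assumes "topological_group G T"
    and "Metric_space (carrier G) d"
    and "Metric_space.mtopology (carrier G) d = T"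
    and "bounded_dist_on (carrier G) d"
    and "right_invariant G d"
    and "\<H> \<subseteq> amenable_subgroups G T"
    and "directed_by_inclusion \<H>"
    and "T closure_of (\<Union>\<H>) = carrier G"
    and "liminf_directed \<H> (\<lambda>H. subgroup_length G T H d) = 0"
  shows "group_length G T = 0 \<and> extremely_amenable TYPE('x) G T"
proof -
  interpret topological_group G T by fact
  have "group_length G T = 0" by (rule group_length_eq_0) fact+
  then show ?thesis using extremely_amenable_of_group_length_eq_0 by blast
qed

end
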